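(* For any $\boldsymbol\theta\in\mathbb R^N_+$, $\mathbf m\in\mathbb R^N_+$, $\sigma>0$ (and any fixed $p>0$) the equilibrium equations $$\sum_{k=1}^N m_k(y_k-y_i)+\sigma(\theta_i-y_i^p)y_i=0,\qquad i=1,\dots,N,$$ have a unique solution $\mathbf y^*\in\mathbb R^N_+$. This $\mathbf y^*$ is a locally exponentially stable equilibrium of system (OY), and the map $(\boldsymbol\theta,\mathbf m,\sigma)\mapsto\mathbf y^*(\boldsymbol\theta,\mathbf m,\sigma)$ from $\mathbb R^N_+\times\mathbb R^N_+\times\mathbb R_+$ to $\mathbb R^N_+$ is $C^\infty$. Moreover, for every sectorial solution $(\mathbf v_1,\dots,\mathbf v_N)$ of system (OV) there exists a unit vector $\tilde{\mathbf v}\in\mathbb S^{n-1}$ such that $\mathbf v_i(t)\to y_i^*\tilde{\mathbf v}$ as $t\to\infty$ for every $i$. In particular, every solution of (OY) with $y_i(0)>0$ for all $i$ converges to $\mathbf y^*$ as $t\to\infty$.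
   Context: $\mathbb R^N_+$ denotes the set of vectors with all coordinates strictly positive. Fix $N\ge1$, $n\ge1$, masses $m_i>0$ with $M=\sum_i m_i$, constants $\theta_i>0$ (constant in time), $\sigma>0$, $p>0$. System (OV) for velocities $\mathbf v_i\in\mathbb R^n$ is $$\dot{\mathbf v}_i=\sum_{j=1}^N m_j(\mathbf v_j-\mathbf v_i)+\sigma(\theta_i-|\mathbf v_i|^p)\mathbf v_i,\quad i=1,\dots,N,$$ ($|\cdot|$ Euclidean norm). A solution of (OV) is sectorial if there exists a unit vector $\mathbf e\in\mathbb R^n$ with $\mathbf e\cdot\mathbf v_i(0)>0$ for all $i$. System (OY) for scalars $y_i$ is $$\dot y_i=\sum_{k=1}^N m_k(y_k-y_i)+\sigma(\theta_i-y_i^p)y_i,\quad i=1,\dots,N.$$ *)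

theory Defs
  imports "HOL-Analysis.Analysis"
begin

definition pos_vec :: "real^'N \<Rightarrow> bool" where
  "pos_vec x \<longleftrightarrow> (\<forall>i. x $ i > 0)"

text \<open>Right-hand side of system (OY). The power y^p is read as |y| powr p
  (it is only ever evaluated at positive y for the solutions of interest).\<close>
definition OY_rhs :: "real \<Rightarrow> real^'N \<Rightarrow> real^'N \<Rightarrow> real \<Rightarrow> real^'N \<Rightarrow> real^'N" where
  "OY_rhs p \<theta> m \<sigma> y =
     (\<chi> i. (\<Sum>k\<in>UNIV. m $ k * (y $ k - y $ i)) + \<sigma> * (\<theta> $ i - \<bar>y $ i\<bar> powr p) * y $ i)"

definition OV_rhs :: "real \<Rightarrow> real^'N \<Rightarrow> real^'N \<Rightarrow> real \<Rightarrow> (real^'n)^'N \<Rightarrow> (real^'n)^'N" where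
  "OV_rhs p \<theta> m \<sigma> v =
     (\<chi> i. (\<Sum>j\<in>UNIV. m $ j *\<^sub>R (v $ j - v $ i)) + (\<sigma> * (\<theta> $ i - norm (v $ i) powr p)) *\<^sub>R v $ i)"

definition ode_solution :: "('a::real_normed_vector \<Rightarrow> 'a) \<Rightarrow> (real \<Rightarrow> 'a) \<Rightarrow> bool" where
  "ode_solution F x \<longleftrightarrow> (\<forall>t\<ge>0. (x has_vector_derivative F (x t)) (at t within {0..}))"

definition sectorial :: "(real \<Rightarrow> (real^'n)^'N) \<Rightarrow> bool" where
  "sectorial v \<longleftrightarrow> (\<exists>e::real^'n. norm e = 1 \<and> (\<forall>i. e \<bullet> (v 0 $ i) > 0))"

definition loc_exp_stable :: "('a::real_normed_vector \<Rightarrow> 'a) \<Rightarrow> 'a \<Rightarrow> bool" where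
  "loc_exp_stable F ystar \<longleftrightarrow> F ystar = 0 \<and>
     (\<exists>\<delta>>0. \<exists>C>0. \<exists>r>0. \<forall>x. ode_solution F x \<and> norm (x 0 - ystar) < \<delta> \<longrightarrow>
        (\<forall>t\<ge>0. norm (x t - ystar) \<le> C * exp (- r * t) * norm (x 0 - ystar)))"

fun Ck_on :: "nat \<Rightarrow> 'a::euclidean_space set \<Rightarrow> ('a \<Rightarrow> 'b::real_normed_vector) \<Rightarrow> bool" where
  "Ck_on 0 S f \<longleftrightarrow> continuous_on S f"
| "Ck_on (Suc k) S f \<longleftrightarrow> f differentiable_on S \<and>
     (\<forall>b\<in>Basis. Ck_on k S (\<lambda>x. frechet_derivative f (at x) b))"

definition Cinf_on :: "'a::euclidean_space set \<Rightarrow> ('a \<Rightarrow> 'b::real_normed_vector) \<Rightarrow> bool" where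
  "Cinf_on S f \<longleftrightarrow> (\<forall>k. Ck_on k S f)"

end

theory Submission
  imports Defs "HOL-Real_Asymp.Real_Asymp"
begin

text \<open>
  Uniqueness of the equilibrium \<open>y\<close> follows by comparing two equilibria at the index where their ratio
  is maximal, existence from Brouwer's theorem. For fixed \<open>(m, \<sigma>)\<close> the equilibrium equations can be
  solved explicitly for \<open>\<theta>\<close>, so the equilibrium map is the inverse of an explicit smooth map; its
  derivative solves a linear system that is a rank-one perturbation of a diagonal one, which gives a
  closed formula in which smoothness bootstraps.

  Writing \<open>v\<^sub>i = y\<^sub>i u\<^sub>i\<close> turns the system (OV) into
  \<open>u\<^sub>i' = \<Sum>\<^sub>k A\<^sub>i\<^sub>k (u\<^sub>k - u\<^sub>i) + b\<^sub>i (1 - |u\<^sub>i|\<^sup>p) u\<^sub>i\<close> with positive \<open>A\<^sub>i\<^sub>k\<close>, \<open>b\<^sub>i\<close>. The radial terms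
  cancel in the ratios \<open>(f \<bullet> u\<^sub>i) / (e \<bullet> u\<^sub>i)\<close>, which therefore obey a linear consensus dynamics and
  converge to a common limit; the maximum principle then drives every \<open>|u\<^sub>i|\<close> to \<open>1\<close>.
\<close>

section \<open>Maximum principles for finite families\<close>

text \<open>First-contact argument: at the earliest time at which some \<open>g j\<close> meets the
  barrier, no other member lies above it, so \<open>touch\<close> makes \<open>g j - c\<close>
  strictly decreasing there. Then it was positive just before, which contradicts minimality of the
  contact time.\<close>

lemma barrier_strict:
  fixes g :: "'i::finite \<Rightarrow> real \<Rightarrow> real"
  assumes dg: "\<And>i t. a \<le> t \<Longrightarrow> t \<le> T \<Longrightarrow> (g i has_real_derivative g' i t) (at t within {a..})"
    and dc: "\<And>t. a \<le> t \<Longrightarrow> t \<le> T \<Longrightarrow> (c has_real_derivative c' t) (at t within {a..})"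
    and init: "\<And>i. g i a < c a"
    and touch: "\<And>i t. a < t \<Longrightarrow> t \<le> T \<Longrightarrow> g i t = c t \<Longrightarrow> (\<And>k. g k t \<le> c t) \<Longrightarrow> g' i t < c' t"
    and t: "a \<le> t" "t \<le> T"
  shows "g i t < c t"
proof (rule ccontr)
  assume "\<not> g i t < c t"
  define h where "h = (\<lambda>i t. g i t - c t)"
  have dh: "(h i has_real_derivative g' i t - c' t) (at t within {a..})" if "a \<le> t" "t \<le> T" for i t
    unfolding h_def using dg[OF that] dc[OF that] by (rule DERIV_diff)
  have cont: "continuous_on {a..T} (h i)" for i
    unfolding continuous_on_eq_continuous_within
    by (metis DERIV_continuous atLeastAtMost_iff continuous_within_subset dh Icc_subset_Ici_iff order_refl)
  \<comment> \<open>All times at which some member is on or above the barrier. Finiteness of the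
    index type makes this set closed, so a first contact time exists.\<close>
  define Z where "Z = (\<Union>i. {a..T} \<inter> h i -` {0..})"
  have "closed Z" unfolding Z_def
    by (intro closed_UN finite ballI continuous_closed_preimage cont closed_atLeast closed_atLeastAtMost)
  moreover have "bounded Z" unfolding Z_def by (rule bounded_subset[of "{a..T}"]) auto
  ultimately have "compact Z" by (simp add: compact_eq_bounded_closed)
  moreover have "t \<in> Z" using t \<open>\<not> g i t < c t\<close> by (auto simp: Z_def h_def not_less intro!: exI[of _ i])
  ultimately obtain s where s: "s \<in> Z" "\<And>r. r \<in> Z \<Longrightarrow> s \<le> r"
    using compact_attains_inf[of Z] by blast
  then obtain j where j: "a \<le> s" "s \<le> T" "h j s \<ge> 0" unfolding Z_def by auto
  have neg: "h k r < 0" if "a \<le> r" "r < s" for k r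
  proof (rule ccontr)
    assume "\<not> h k r < 0"
    then have "r \<in> Z" using that j by (auto simp: Z_def not_less intro!: exI[of _ k])
    then show False using s(2) that by force
  qed
  have "s \<noteq> a" using j init[of j] unfolding h_def by force
  then have "a < s" using j by simp
  \<comment> \<open>A member strictly above the barrier at \<open>s\<close> would have crossed it
    earlier by the intermediate value theorem, since it starts strictly below.\<close>
  have le: "h k s \<le> 0" for k
  proof (rule ccontr)
    assume "\<not> h k s \<le> 0"
    moreover have "h k a < 0" using init unfolding h_def by simp
    ultimately obtain r where r: "a \<le> r" "r \<le> s" "h k r = 0"
      using IVT'[of "h k" a 0 s] j continuous_on_subset[OF cont, of "{a..s}" k] by auto
    with neg[of r k] have "r = s" by force
    with r \<open>\<not> h k s \<le> 0\<close> show False by simp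
  qed
  have "h j s = 0" using j le[of j] by simp
  then have "g' j s < c' s"
    using touch[of s j] \<open>a < s\<close> j le unfolding h_def by simp
  then obtain d where d: "d > 0" "\<And>r. r > 0 \<Longrightarrow> s - r \<in> {a..} \<Longrightarrow> r < d \<Longrightarrow> h j s < h j (s - r)"
    using has_real_derivative_neg_dec_left[OF dh[OF j(1,2), of j]] by auto
  define r where "r = min (d/2) (s - a)"
  have "r > 0" "s - r \<in> {a..}" "r < d" using d \<open>a < s\<close> unfolding r_def by auto
  from d(2)[OF this] neg[of "s - r" j] \<open>h j s = 0\<close> \<open>r > 0\<close> \<open>s - r \<in> {a..}\<close> show False by simp
qed

text \<open>Adding a small increasing linear function to \<open>c\<close> makes both the initial and
  the contact inequality strict, so \<open>barrier_strict\<close> applies; then the perturbation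
  tends to zero. The sign condition is asked only of a member that is maximal in the family and lies
  above \<open>c\<close>.\<close>

lemma barrier:
  fixes g :: "'i::finite \<Rightarrow> real \<Rightarrow> real"
  assumes dg: "\<And>i t. a \<le> t \<Longrightarrow> (g i has_real_derivative g' i t) (at t within {a..})"
    and dc: "\<And>t. a \<le> t \<Longrightarrow> (c has_real_derivative c' t) (at t within {a..})"
    and init: "\<And>i. g i a \<le> c a"
    and above: "\<And>i t. a < t \<Longrightarrow> c t < g i t \<Longrightarrow> (\<And>k. g k t \<le> g i t) \<Longrightarrow> g' i t \<le> c' t"
    and t: "a \<le> t"
  shows "g i t \<le> c t"
proof (rule field_le_epsilon)
  fix e :: real assume e: "e > 0"
  \<comment> \<open>Normalised so that the perturbation \<open>d * (1 + (t - a))\<close> equals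
    \<open>e\<close> at the final time \<open>t\<close>.\<close>
  define d where "d = e / (1 + (t - a))"
  have d: "d > 0" using e t unfolding d_def by simp
  have "g i t < c t + d * (1 + (t - a))"
  proof (rule barrier_strict[where a = a and T = t and c' = "\<lambda>t. c' t + d"
        and c = "\<lambda>t. c t + d * (1 + (t - a))"])
    fix s assume s: "a \<le> s"
    show "((\<lambda>t. c t + d * (1 + (t - a))) has_real_derivative c' s + d) (at s within {a..})"
      by (auto intro!: derivative_eq_intros dc s)
  next
    fix j show "g j a < c a + d * (1 + (a - a))" using init[of j] d by simp
  next
    fix j s assume s: "a < s" "g j s = c s + d * (1 + (s - a))" "\<And>k. g k s \<le> c s + d * (1 + (s - a))"
    have "d * (1 + (s - a)) > 0" using d s by simp
    then have "g' j s \<le> c' s" using s by (intro above) auto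
    then show "g' j s < c' s + d" using d by simp
  qed (use dg t in auto)
  also have "d * (1 + (t - a)) = e" using t unfolding d_def by simp
  finally show "g i t \<le> c t + e" by simp
qed

text \<open>While above \<open>q\<close>, the maximum of the family falls at rate at least \<eta>.
  The barrier \<open>q + B * exp (- l * (t - a))\<close> never falls faster than that, stays above
  \<open>q\<close>, and tends to \<open>q\<close>.\<close>

lemma eventually_below_level:
  fixes g :: "'i::finite \<Rightarrow> real \<Rightarrow> real"
  assumes dg: "\<And>i t. a \<le> t \<Longrightarrow> (g i has_real_derivative g' i t) (at t within {a..})"
    and decr: "\<And>i t. a \<le> t \<Longrightarrow> q < g i t \<Longrightarrow> (\<And>k. g k t \<le> g i t) \<Longrightarrow> g' i t \<le> - \<eta>"
    and \<eta>: "\<eta> > 0" and q: "q < q'"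
  shows "eventually (\<lambda>t. g i t < q') at_top"
proof -
  \<comment> \<open>The added 1 makes \<open>B\<close> positive; \<open>l = \<eta> / B\<close> then
    gives the barrier the slope -\<eta> at time \<open>a\<close>, and a flatter one
    afterwards.\<close>
  define B where "B = Max (range (\<lambda>i. \<bar>g i a - q\<bar>)) + 1"
  have B: "\<bar>g i a - q\<bar> + 1 \<le> B" for i unfolding B_def by simp
  then have "B > 0" using B[of undefined] by linarith
  define l where "l = \<eta> / B"
  have l: "l > 0" using \<eta> \<open>B > 0\<close> unfolding l_def by simp
  have le: "g i t \<le> q + B * exp (- l * (t - a))" if "a \<le> t" for t
  proof (rule barrier[where a = a and c' = "\<lambda>t. - \<eta> * exp (- l * (t - a))", OF dg _ _ _ that])
    fix s assume "a \<le> s"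
    show "((\<lambda>t. q + B * exp (- l * (t - a))) has_real_derivative - \<eta> * exp (- l * (s - a))) (at s within {a..})"
      using \<open>B > 0\<close> unfolding l_def by (auto intro!: derivative_eq_intros)
  next
    fix j show "g j a \<le> q + B * exp (- l * (a - a))" using B[of j] by simp
  next
    fix j s assume s: "a < s" "q + B * exp (- l * (s - a)) < g j s" "\<And>k. g k s \<le> g j s"
    have "B * exp (- l * (s - a)) > 0" using \<open>B > 0\<close> by simp
    then have "g' j s \<le> - \<eta>" using s by (intro decr) auto
    also have "\<dots> \<le> - \<eta> * exp (- l * (s - a))" using s \<eta> l by simp
    finally show "g' j s \<le> - \<eta> * exp (- l * (s - a))" .
  qed
  have "((\<lambda>t. q + B * exp (- l * (t - a))) \<longlongrightarrow> q) at_top"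
    using l by real_asymp
  then have "eventually (\<lambda>t. q + B * exp (- l * (t - a)) < q') at_top"
    using q by (rule order_tendstoD)
  then show ?thesis using eventually_ge_at_top[of a]
    by eventually_elim (use le in force)
qed

section \<open>Functions of class Ck\<close>

lemma has_derivative_vecI:
  fixes f :: "'a::euclidean_space \<Rightarrow> real^'N"
  assumes "\<And>i. ((\<lambda>x. f x $ i) has_derivative (\<lambda>h. D h $ i)) (at x)"
  shows "(f has_derivative D) (at x)"
proof (rule has_derivative_componentwise_within[THEN iffD2], rule ballI)
  fix b :: "real^'N" assume "b \<in> Basis"
  then obtain i where b: "b = axis i 1" by (auto simp: Basis_vec_def)
  show "((\<lambda>x. f x \<bullet> b) has_derivative (\<lambda>h. D h \<bullet> b)) (at x)"
    using assms[of i] by (simp add: b inner_axis)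
qed

lemma has_derivative_cong_open:
  assumes "open S" "x \<in> S" "\<And>x. x \<in> S \<Longrightarrow> f x = g x"
  shows "(f has_derivative D) (at x) \<longleftrightarrow> (g has_derivative D) (at x)"
  using has_derivative_transform_within_open[of f D x UNIV S g]
    has_derivative_transform_within_open[of g D x UNIV S f] assms by auto

text \<open>On an open set the two functions have the same derivative predicate at each point. As
  \<open>frechet_derivative\<close> is a choice from that predicate, the chosen derivatives coincide
  as well, and the induction can continue.\<close>

lemma Ck_on_cong:
  assumes "open S" "\<And>x. x \<in> S \<Longrightarrow> f x = g x"
  shows "Ck_on k S f \<longleftrightarrow> Ck_on k S g"
  using assms(2)
proof (induction k arbitrary: f g)
  case 0
  then show ?case by (auto cong: continuous_on_cong)
next
  case (Suc k)
  have "f differentiable_on S \<longleftrightarrow> g differentiable_on S"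
    unfolding differentiable_on_eq_differentiable_at[OF assms(1)] differentiable_def
    using has_derivative_cong_open[OF assms(1) _ Suc.prems] by simp
  moreover have "Ck_on k S (\<lambda>x. frechet_derivative f (at x) b) \<longleftrightarrow> Ck_on k S (\<lambda>x. frechet_derivative g (at x) b)" for b
    by (rule Suc.IH)
      (simp add: frechet_derivative_def has_derivative_cong_open[OF assms(1) _ Suc.prems])
  ultimately show ?case by simp
qed

text \<open>Allows an explicit derivative formula to replace the chosen
  \<open>frechet_derivative\<close>; the closure rules and the final bootstrap rest on it.\<close>

lemma Ck_on_SucI:
  assumes S: "open S" and d: "\<And>x. x \<in> S \<Longrightarrow> (f has_derivative D x) (at x)"
    and D: "\<And>b. b \<in> Basis \<Longrightarrow> Ck_on k S (\<lambda>x. D x b)"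
  shows "Ck_on (Suc k) S f"
proof -
  have "f differentiable_on S"
    using d by (auto simp: differentiable_on_eq_differentiable_at[OF S] differentiable_def)
  moreover have "frechet_derivative f (at x) = D x" if "x \<in> S" for x
    using d[OF that] by (metis frechet_derivative_at)
  then have "Ck_on k S (\<lambda>x. frechet_derivative f (at x) b)" if "b \<in> Basis" for b
    using Ck_on_cong[OF S, of "\<lambda>x. frechet_derivative f (at x) b" "\<lambda>x. D x b"] D[OF that] by simp
  ultimately show ?thesis by simp
qed

lemma Ck_on_Suc_has_derivative:
  assumes "open S" "Ck_on (Suc k) S f" "x \<in> S"
  shows "(f has_derivative frechet_derivative f (at x)) (at x)"
  using assms(2,3)
  by (simp add: differentiable_on_eq_differentiable_at[OF assms(1)] frechet_derivative_works)

lemma Ck_on_SucD: "Ck_on (Suc k) S f \<Longrightarrow> Ck_on k S f"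
proof (induction k arbitrary: f)
  case 0
  then show ?case by (auto intro: differentiable_imp_continuous_on)
next
  case (Suc k)
  then show ?case by (metis Ck_on.simps(2))
qed

lemma Ck_on_const: "open S \<Longrightarrow> Ck_on k S (\<lambda>x. c)"
proof (induction k arbitrary: c)
  case (Suc k)
  show ?case by (rule Ck_on_SucI[OF Suc.prems has_derivative_const Suc.IH[OF Suc.prems]])
qed simp

lemma Ck_on_bounded_linear:
  assumes "open S" "bounded_linear f"
  shows "Ck_on k S f"
proof (cases k)
  case 0
  then show ?thesis using assms by (simp add: linear_continuous_on)
next
  case (Suc n)
  then show ?thesis
    using Ck_on_SucI[OF assms(1) bounded_linear.has_derivative[OF assms(2) has_derivative_ident]
        Ck_on_const[OF assms(1)]] by simp
qed

lemma Ck_on_add: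
  assumes "open S" "Ck_on k S f" "Ck_on k S g"
  shows "Ck_on k S (\<lambda>x. f x + g x)"
  using assms(2,3)
proof (induction k arbitrary: f g)
  case 0
  then show ?case by (simp add: continuous_on_add)
next
  case (Suc k)
  show ?case
    by (rule Ck_on_SucI[OF assms(1)
        has_derivative_add[OF Ck_on_Suc_has_derivative[OF assms(1) Suc.prems(1)]
          Ck_on_Suc_has_derivative[OF assms(1) Suc.prems(2)]]])
      (use Suc in auto)
qed

lemma Ck_on_sum:
  assumes "open S" "\<And>i. i \<in> I \<Longrightarrow> Ck_on k S (f i)"
  shows "Ck_on k S (\<lambda>x. \<Sum>i\<in>I. f i x)"
  using assms(2)
  by (induction I rule: infinite_finite_induct)
    (simp_all add: Ck_on_const[OF assms(1)] Ck_on_add[OF assms(1)])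

lemma Ck_on_mult:
  fixes f g :: "'a::euclidean_space \<Rightarrow> real"
  assumes "open S" "Ck_on k S f" "Ck_on k S g"
  shows "Ck_on k S (\<lambda>x. f x * g x)"
  using assms(2,3)
proof (induction k arbitrary: f g)
  case 0
  then show ?case by (simp add: continuous_on_mult)
next
  case (Suc k)
  \<comment> \<open>The product rule also contains the undifferentiated factors, so these are first
    demoted from order \<open>Suc k\<close> to \<open>k\<close>.\<close>
  have fg: "Ck_on k S f" "Ck_on k S g" using Suc.prems by (blast dest: Ck_on_SucD)+
  show ?case
    by (rule Ck_on_SucI[OF assms(1)
        has_derivative_mult[OF Ck_on_Suc_has_derivative[OF assms(1) Suc.prems(1)]
          Ck_on_Suc_has_derivative[OF assms(1) Suc.prems(2)]]])
      (use Suc.prems fg in \<open>auto intro!: Ck_on_add[OF assms(1)] Suc.IH\<close>)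
qed

lemma Ck_on_uminus:
  fixes f :: "'a::euclidean_space \<Rightarrow> real"
  assumes "open S" "Ck_on k S f"
  shows "Ck_on k S (\<lambda>x. - f x)"
  using Ck_on_mult[OF assms(1) Ck_on_const[OF assms(1), of k "-1"] assms(2)] by simp

lemma Ck_on_diff:
  fixes f g :: "'a::euclidean_space \<Rightarrow> real"
  assumes "open S" "Ck_on k S f" "Ck_on k S g"
  shows "Ck_on k S (\<lambda>x. f x - g x)"
  using Ck_on_add[OF assms(1,2) Ck_on_uminus[OF assms(1,3)]] by simp

text \<open>Differentiation replaces the exponent \<open>a\<close> by \<open>a - 1\<close>, so the
  induction runs over all real exponents at once; positivity keeps the base away from the
  singularity at 0.\<close>

lemma Ck_on_powr:
  fixes f :: "'a::euclidean_space \<Rightarrow> real"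
  assumes "open S" "Ck_on k S f" "\<And>x. x \<in> S \<Longrightarrow> f x > 0"
  shows "Ck_on k S (\<lambda>x. f x powr a)"
  using assms(2)
proof (induction k arbitrary: a)
  case 0
  have "f x \<noteq> 0" if "x \<in> S" for x using assms(3)[OF that] by simp
  with 0 show ?case by (simp add: continuous_on_powr)
next
  case (Suc k)
  have "((\<lambda>x. f x powr a) has_derivative (\<lambda>h. (a * f x powr (a - 1)) * frechet_derivative f (at x) h)) (at x)"
    if "x \<in> S" for x
    using Ck_on_Suc_has_derivative[OF assms(1) Suc.prems that] assms(3)[OF that]
    by (auto intro!: derivative_eq_intros simp: powr_diff)
  then show ?case
    by (rule Ck_on_SucI[OF assms(1)])
      (use Suc.prems Suc.IH[OF Ck_on_SucD[OF Suc.prems]] in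
        \<open>auto intro!: Ck_on_mult[OF assms(1)] Ck_on_const[OF assms(1)]\<close>)
qed

lemma Ck_on_divide:
  fixes f g :: "'a::euclidean_space \<Rightarrow> real"
  assumes "open S" "Ck_on k S f" "Ck_on k S g" "\<And>x. x \<in> S \<Longrightarrow> g x > 0"
  shows "Ck_on k S (\<lambda>x. f x / g x)"
proof -
  have "Ck_on k S (\<lambda>x. f x * g x powr - 1)"
    by (intro Ck_on_mult Ck_on_powr assms)
  then show ?thesis
    using Ck_on_cong[OF assms(1), of "\<lambda>x. f x * g x powr - 1" "\<lambda>x. f x / g x" k] assms(4)
    by (simp add: powr_minus divide_inverse less_imp_le)
qed

lemma Ck_on_vecI:
  fixes f :: "'a::euclidean_space \<Rightarrow> real^'N"
  assumes "open S" "\<And>i. Ck_on k S (\<lambda>x. f x $ i)"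
  shows "Ck_on k S f"
  using assms(2)
proof (induction k arbitrary: f)
  case 0
  then have "continuous_on S (\<lambda>x. \<chi> i. f x $ i)"
    unfolding Ck_on.simps by (rule continuous_on_vec_lambda)
  then show ?case unfolding Ck_on.simps vec_lambda_eta .
next
  case (Suc k)
  let ?D = "\<lambda>x b. \<chi> i. frechet_derivative (\<lambda>x. f x $ i) (at x) b"
  have "(f has_derivative ?D x) (at x)" if "x \<in> S" for x
    using Ck_on_Suc_has_derivative[OF assms(1) Suc.prems that] by (intro has_derivative_vecI) simp
  then show ?case
  proof (rule Ck_on_SucI[OF assms(1)])
    fix b :: 'a assume b: "b \<in> Basis"
    have "Ck_on k S (\<lambda>x. frechet_derivative (\<lambda>x. f x $ i) (at x) b)" for i
      using Suc.prems[of i] b by simp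
    then show "Ck_on k S (\<lambda>x. ?D x b)" by (intro Suc.IH) simp
  qed
qed

section \<open>The equilibrium\<close>

lemma OY_rhs_eq_0_iff:
  assumes "pos_vec y"
  shows "OY_rhs p \<theta> m \<sigma> y = 0 \<longleftrightarrow>
    (\<forall>i. (\<Sum>k\<in>UNIV. m $ k * (y $ k - y $ i)) + \<sigma> * (\<theta> $ i - y $ i powr p) * y $ i = 0)"
  using assms by (simp add: OY_rhs_def vec_eq_iff pos_vec_def abs_of_pos)

text \<open>Let \<open>l\<close> be the largest ratio of \<open>y\<close> to \<open>z\<close>,
  attained at \<open>j\<close>, so that \<open>l * z\<close> touches \<open>y\<close> from above at
  \<open>j\<close>. If \<open>l > 1\<close>, the coupling term of \<open>y\<close> at
  \<open>j\<close> is at most \<open>l\<close> times that of \<open>z\<close>, while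
  \<open>y $ j > z $ j\<close> makes the growth factor of \<open>y\<close> strictly smaller; both
  equations cannot then balance.\<close>

lemma equilibrium_le:
  fixes y z m \<theta> :: "real^'N"
  assumes p: "p > 0" and \<sigma>: "\<sigma> > 0" and m: "pos_vec m"
    and y: "pos_vec y" "OY_rhs p \<theta> m \<sigma> y = 0"
    and z: "pos_vec z" "OY_rhs p \<theta> m \<sigma> z = 0"
  shows "y $ i \<le> z $ i"
proof (rule ccontr)
  assume gt: "\<not> y $ i \<le> z $ i"
  have ypos: "y $ k > 0" and zpos: "z $ k > 0" and mpos: "m $ k > 0" for k
    using y z m by (auto simp: pos_vec_def)
  define l where "l = Max (range (\<lambda>k. y $ k / z $ k))"
  have le: "y $ k \<le> l * z $ k" for k
  proof -
    have "y $ k / z $ k \<le> l" unfolding l_def by simp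
    then show ?thesis using zpos[of k] by (simp add: divide_simps)
  qed
  have "l \<in> range (\<lambda>k. y $ k / z $ k)" unfolding l_def by (intro Max_in) auto
  then obtain j where j: "l = y $ j / z $ j" by auto
  then have yj: "y $ j = l * z $ j" using zpos[of j] by simp
  \<comment> \<open>The index \<open>i\<close> assumed to violate the claim has ratio above 1, hence
    so does the maximum.\<close>
  have l1: "l > 1"
  proof (rule ccontr)
    assume "\<not> l > 1"
    then have "l * z $ i \<le> z $ i" using zpos[of i] by simp
    then show False using le[of i] gt by simp
  qed
  have yeq: "(\<Sum>k\<in>UNIV. m $ k * (y $ k - y $ j)) + \<sigma> * (\<theta> $ j - y $ j powr p) * y $ j = 0"
    using y by (simp add: OY_rhs_eq_0_iff)
  have zeq: "(\<Sum>k\<in>UNIV. m $ k * (z $ k - z $ j)) + \<sigma> * (\<theta> $ j - z $ j powr p) * z $ j = 0"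
    using z by (simp add: OY_rhs_eq_0_iff)
  have "(\<Sum>k\<in>UNIV. m $ k * (y $ k - y $ j)) \<le> (\<Sum>k\<in>UNIV. l * (m $ k * (z $ k - z $ j)))"
  proof (rule sum_mono)
    fix k
    have "m $ k * (y $ k - y $ j) \<le> m $ k * (l * z $ k - l * z $ j)"
      using le[of k] yj mpos[of k] by simp
    then show "m $ k * (y $ k - y $ j) \<le> l * (m $ k * (z $ k - z $ j))"
      by (simp add: algebra_simps)
  qed
  also have "\<dots> = l * - (\<sigma> * (\<theta> $ j - z $ j powr p) * z $ j)"
    unfolding sum_distrib_left[symmetric] using zeq[THEN eq_neg_iff_add_eq_0[THEN iffD2]] by simp
  also have "\<dots> = - \<sigma> * (\<theta> $ j - z $ j powr p) * y $ j" using yj by simp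
  finally have "0 \<le> (- \<sigma> * (\<theta> $ j - z $ j powr p) + \<sigma> * (\<theta> $ j - y $ j powr p)) * y $ j"
    using yeq by (simp add: algebra_simps)
  then have "0 \<le> \<sigma> * (z $ j powr p - y $ j powr p)"
    using ypos[of j] by (simp add: zero_le_mult_iff right_diff_distrib)
  then have "y $ j powr p \<le> z $ j powr p" using \<sigma> by (simp add: zero_le_mult_iff)
  moreover have "z $ j powr p < y $ j powr p"
    using l1 zpos[of j] p yj by (intro powr_less_mono2) auto
  ultimately show False by simp
qed

lemma equilibrium_unique:
  fixes y z m \<theta> :: "real^'N"
  assumes "p > 0" "\<sigma> > 0" "pos_vec m"
    and "pos_vec y" "OY_rhs p \<theta> m \<sigma> y = 0" "pos_vec z" "OY_rhs p \<theta> m \<sigma> z = 0"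
  shows "y = z"
  unfolding vec_eq_iff
  using equilibrium_le[OF assms] equilibrium_le[OF assms(1-3,6,7,4,5)] order_antisym by blast

text \<open>Without coupling, component \<open>i\<close> would rest at
  \<open>\<theta> $ i powr (1/p)\<close>. On the cube between the least and the greatest of these
  values the vector field never points outward, which lets Brouwer's theorem produce a zero.\<close>

lemma equilibrium_exists:
  fixes m \<theta> :: "real^'N"
  assumes p: "p > 0" and \<sigma>: "\<sigma> > 0" and m: "pos_vec m" and \<theta>: "pos_vec \<theta>"
  shows "\<exists>y. pos_vec y \<and> OY_rhs p \<theta> m \<sigma> y = 0"
proof -
  define a where "a = Min (range (\<lambda>i. \<theta> $ i powr (1/p)))"
  define b where "b = Max (range (\<lambda>i. \<theta> $ i powr (1/p)))"
  have \<theta>pos: "\<theta> $ k > 0" and mpos: "m $ k > 0" for k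
    using m \<theta> by (auto simp: pos_vec_def)
  have ai: "a \<le> \<theta> $ i powr (1/p)" and bi: "\<theta> $ i powr (1/p) \<le> b" for i
    unfolding a_def b_def by auto
  have ab: "a \<le> b" using ai[of undefined] bi[of undefined] by simp
  have "a \<in> range (\<lambda>i. \<theta> $ i powr (1/p))" unfolding a_def by (intro Min_in) auto
  then have apos: "a > 0" using \<theta>pos by (auto simp: less_imp_neq[THEN not_sym])
  have ap: "a powr p \<le> \<theta> $ i" and bp: "\<theta> $ i \<le> b powr p" for i
  proof -
    have *: "(\<theta> $ i powr (1/p)) powr p = \<theta> $ i" using p \<theta>pos[of i] by (simp add: powr_powr)
    show "a powr p \<le> \<theta> $ i" using powr_mono2[of p a "\<theta> $ i powr (1/p)"] ai[of i] apos p * by simp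
    show "\<theta> $ i \<le> b powr p" using powr_mono2[of p "\<theta> $ i powr (1/p)" b] bi[of i] p * by simp
  qed
  define F where "F = (\<lambda>y::real^'N. OY_rhs p \<theta> m \<sigma> y)"
  \<comment> \<open>A unit Euler step, clipped back into the cube so that it is a self-map.\<close>
  define G where "G = (\<lambda>y::real^'N. (\<chi> i. max a (min b (y $ i + F y $ i))) :: real^'N)"
  define S where "S = (cbox (\<chi> i. a) (\<chi> i. b) :: (real^'N) set)"
  have S: "y \<in> S \<longleftrightarrow> (\<forall>i. a \<le> y $ i \<and> y $ i \<le> b)" for y :: "real^'N"
    unfolding S_def by (auto simp: mem_box_cart)
  have "continuous_on S G"
    unfolding G_def F_def OY_rhs_def using apos
    by (auto simp: S intro!: continuous_intros) (metis less_le_trans less_irrefl)+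
  moreover have "G \<in> S \<rightarrow> S" using ab by (auto simp: S G_def)
  moreover have "S \<noteq> {}" using ab S[of "\<chi> i. a"] by auto
  ultimately obtain y where y: "y \<in> S" "G y = y"
    using brouwer[of S G] unfolding S_def by (metis compact_cbox convex_box(1))
  have yb: "a \<le> y $ i" "y $ i \<le> b" for i using y S by auto
  have ypos: "y $ i > 0" for i using apos yb(1)[of i] by simp
  have fix_i: "max a (min b (y $ i + F y $ i)) = y $ i" for i
    using y(2) unfolding G_def by (metis vec_lambda_beta)
  have Fi: "F y $ i = (\<Sum>k\<in>UNIV. m $ k * (y $ k - y $ i)) + \<sigma> * (\<theta> $ i - y $ i powr p) * y $ i" for i
    using ypos[of i] unfolding F_def OY_rhs_def by simp
  \<comment> \<open>Strictly inside the cube a fixed point of \<open>G\<close> is a zero of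
    \<open>F\<close>. Clipping could hide only a negative component on a lower face or a positive
    one on an upper face; \<open>lo\<close> and \<open>hi\<close> exclude these.\<close>
  have lo: "F y $ i \<ge> 0" if "y $ i = a" for i
    unfolding Fi that using yb ap[of i] mpos apos \<sigma>
    by (intro add_nonneg_nonneg sum_nonneg mult_nonneg_nonneg) (auto simp: less_imp_le)
  have hi: "F y $ i \<le> 0" if "y $ i = b" for i
    unfolding Fi that using yb bp[of i] mpos apos ab \<sigma>
    by (intro add_nonpos_nonpos sum_nonpos mult_nonneg_nonpos mult_nonpos_nonneg) (auto simp: less_imp_le)
  have "F y $ i = 0" for i
    using fix_i[of i] lo[of i] hi[of i] yb[of i] by (auto simp: max_def min_def split: if_splits)
  then have "F y = 0" by (simp add: vec_eq_iff)
  then show ?thesis using ypos by (auto simp: F_def pos_vec_def)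
qed

section \<open>The equilibrium map and its smooth dependence on the parameters\<close>

definition equilibrium :: "real \<Rightarrow> (real^'N) \<times> (real^'N) \<times> real \<Rightarrow> real^'N" where
  "equilibrium p x = (THE y. pos_vec y \<and> OY_rhs p (fst x) (fst (snd x)) (snd (snd x)) y = 0)"

abbreviation pos_params :: "((real^'N) \<times> (real^'N) \<times> real) set" where
  "pos_params \<equiv> {(\<theta>, m, \<sigma>). pos_vec \<theta> \<and> pos_vec m \<and> \<sigma> > 0}"

lemma equilibrium_eqI:
  assumes "p > 0" "\<sigma> > 0" "pos_vec m" "pos_vec y" "OY_rhs p \<theta> m \<sigma> y = 0"
  shows "equilibrium p (\<theta>, m, \<sigma>) = y"
  unfolding equilibrium_def using assms by (intro the_equality) (auto intro: equilibrium_unique)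

lemma equilibrium:
  assumes "p > 0" "\<sigma> > 0" "pos_vec m" "pos_vec \<theta>"
  shows "pos_vec (equilibrium p (\<theta>, m, \<sigma>))" "OY_rhs p \<theta> m \<sigma> (equilibrium p (\<theta>, m, \<sigma>)) = 0"
  using equilibrium_exists[OF assms] equilibrium_eqI[OF assms(1-3)] by auto

lemma open_pos_params: "open (pos_params :: ((real^'N) \<times> (real^'N) \<times> real) set)"
proof -
  have "{y :: real^'N. pos_vec y} = (\<Inter>i. {y. 0 < y $ i})" by (auto simp: pos_vec_def)
  moreover have "open \<dots>" by (intro open_INT finite ballI open_Collect_less continuous_intros)
  ultimately have "open {y :: real^'N. pos_vec y}" by simp
  then have "open ({y :: real^'N. pos_vec y} \<times> {y :: real^'N. pos_vec y} \<times> {0::real<..})"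
    by (intro open_Times open_greaterThan)
  also have "({y :: real^'N. pos_vec y} \<times> {y :: real^'N. pos_vec y} \<times> {0::real<..}) = pos_params" by auto
  finally show ?thesis .
qed

text \<open>The equilibrium equations solved for \<theta>. Carrying (m, \<sigma>) along unchanged
  turns this into a map of the parameter space to itself, as the inverse function theorem requires;
  its inverse sends \<open>x\<close> to \<open>(equilibrium p x, snd x)\<close>.\<close>

definition theta_of :: "real \<Rightarrow> (real^'N) \<times> (real^'N) \<times> real \<Rightarrow> (real^'N) \<times> (real^'N) \<times> real" where
  "theta_of p x = ((\<chi> i. fst x $ i powr p
      - (\<Sum>k\<in>UNIV. fst (snd x) $ k * (fst x $ k - fst x $ i)) / (snd (snd x) * fst x $ i)), snd x)"

lemma OY_rhs_eq_0_iff_theta_of: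
  assumes "pos_vec y" "\<sigma> > 0"
  shows "OY_rhs p \<theta> m \<sigma> y = 0 \<longleftrightarrow> theta_of p (y, m, \<sigma>) = (\<theta>, m, \<sigma>)"
proof -
  have "(\<Sum>k\<in>UNIV. m $ k * (y $ k - y $ i)) + \<sigma> * (\<theta> $ i - y $ i powr p) * y $ i = 0 \<longleftrightarrow>
      y $ i powr p - (\<Sum>k\<in>UNIV. m $ k * (y $ k - y $ i)) / (\<sigma> * y $ i) = \<theta> $ i" for i
  proof -
    have "0 < \<sigma> * y $ i" using assms by (simp add: pos_vec_def)
    moreover have "a + q * (c - d) = 0 \<longleftrightarrow> d - a / q = c" if "0 < q" for a c d q :: real
      using that by (auto simp: field_simps)
    moreover have "\<sigma> * (\<theta> $ i - y $ i powr p) * y $ i = (\<sigma> * y $ i) * (\<theta> $ i - y $ i powr p)" by simp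
    ultimately show ?thesis by presburger
  qed
  then show ?thesis
    unfolding OY_rhs_eq_0_iff[OF assms(1)] by (simp add: theta_of_def vec_eq_iff)
qed

text \<open>Differentiating the equilibrium equations in the direction \<open>b\<close> of the parameters gives the system
  \<open>lin_diag\<^sub>i w\<^sub>i - \<Sum>\<^sub>k m\<^sub>k w\<^sub>k = lin_rhs\<^sub>i\<close> for the derivative \<open>w\<close> of the equilibrium. Its solution is
  \<open>lin_sol\<close>, obtained by first solving for \<open>\<Sum>\<^sub>k m\<^sub>k w\<^sub>k\<close>.\<close>

definition lin_diag :: "real \<Rightarrow> real^'N \<Rightarrow> real^'N \<Rightarrow> real \<Rightarrow> 'N \<Rightarrow> real" where
  "lin_diag p y m \<sigma> i = \<sigma> * p * y $ i powr p + (\<Sum>k\<in>UNIV. m $ k * y $ k) / y $ i"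

definition lin_rhs :: "real^'N \<Rightarrow> real^'N \<Rightarrow> real \<Rightarrow> (real^'N) \<times> (real^'N) \<times> real \<Rightarrow> 'N \<Rightarrow> real" where
  "lin_rhs y m \<sigma> b i = \<sigma> * y $ i * fst b $ i + (\<Sum>k\<in>UNIV. fst (snd b) $ k * (y $ k - y $ i))
      - snd (snd b) / \<sigma> * (\<Sum>k\<in>UNIV. m $ k * (y $ k - y $ i))"

definition lin_sol :: "real \<Rightarrow> real^'N \<Rightarrow> real^'N \<Rightarrow> real \<Rightarrow> (real^'N) \<times> (real^'N) \<times> real \<Rightarrow> 'N \<Rightarrow> real" where
  "lin_sol p y m \<sigma> b i = (lin_rhs y m \<sigma> b i
      + (\<Sum>j\<in>UNIV. m $ j * lin_rhs y m \<sigma> b j / lin_diag p y m \<sigma> j)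
        / (1 - (\<Sum>j\<in>UNIV. m $ j / lin_diag p y m \<sigma> j))) / lin_diag p y m \<sigma> i"

lemma lin_diag_pos:
  assumes "p > 0" "\<sigma> > 0" "pos_vec m" "pos_vec y"
  shows "lin_diag p y m \<sigma> i > 0"
  unfolding lin_diag_def using assms
  by (intro add_pos_nonneg mult_pos_pos divide_nonneg_pos sum_nonneg)
    (auto simp: pos_vec_def less_imp_le less_imp_neq[THEN not_sym])

text \<open>Each diagonal entry exceeds \<open>S / y $ j\<close> with \<open>S\<close> the sum of
  all \<open>m $ k * y $ k\<close>, and the weights \<open>m $ j * y $ j / S\<close> add up to 1.
  This keeps the denominator in \<open>lin_sol\<close> positive.\<close>

lemma lin_diag_sum:
  fixes m y :: "real^'N"
  assumes "p > 0" "\<sigma> > 0" "pos_vec m" "pos_vec y"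
  shows "(\<Sum>j\<in>UNIV. m $ j / lin_diag p y m \<sigma> j) < 1"
proof -
  have pos: "m $ j > 0" "y $ j > 0" for j using assms by (auto simp: pos_vec_def)
  define S where "S = (\<Sum>k\<in>UNIV. m $ k * y $ k)"
  have S: "S > 0" unfolding S_def using pos by (intro sum_pos) auto
  have "(\<Sum>j\<in>UNIV. m $ j / lin_diag p y m \<sigma> j) < (\<Sum>j\<in>UNIV. m $ j / (S / y $ j))"
  proof (rule sum_strict_mono)
    fix j
    have "S / y $ j < lin_diag p y m \<sigma> j"
      unfolding lin_diag_def S_def using assms pos(2)[of j] by simp
    then show "m $ j / lin_diag p y m \<sigma> j < m $ j / (S / y $ j)"
      using S pos by (intro divide_strict_left_mono mult_pos_pos lin_diag_pos[OF assms]) auto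
  qed auto
  also have "\<dots> = (\<Sum>j\<in>UNIV. m $ j * y $ j / S)" by simp
  also have "\<dots> = S / S" unfolding sum_divide_distrib[symmetric] by (simp only: S_def)
  also have "\<dots> = 1" using S by simp
  finally show ?thesis .
qed

text \<open>The unknowns are coupled only through the weighted sum \<open>S\<close>. Expressing each
  \<open>w i\<close> by \<open>S\<close>, multiplying by \<open>m $ i\<close> and summing leaves one
  scalar equation for \<open>S\<close>. Existence of a solution is supplied later by injectivity of
  a linear self-map.\<close>

lemma lin_solI:
  fixes m y :: "real^'N"
  assumes pos: "p > 0" "\<sigma> > 0" "pos_vec m" "pos_vec y"
    and eq: "\<And>i. lin_diag p y m \<sigma> i * w i - (\<Sum>k\<in>UNIV. m $ k * w k) = lin_rhs y m \<sigma> b i"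
  shows "w i = lin_sol p y m \<sigma> b i"
proof -
  define S where "S = (\<Sum>k\<in>UNIV. m $ k * w k)"
  let ?d = "lin_diag p y m \<sigma>" and ?G = "lin_rhs y m \<sigma> b"
  have d: "?d i > 0" for i by (rule lin_diag_pos[OF pos])
  have w: "w i = (?G i + S) / ?d i" for i using eq[of i, folded S_def] d[of i] by (simp add: field_simps)
  have "m $ j * w j = m $ j * ?G j / ?d j + S * (m $ j / ?d j)" for j
    unfolding w[of j] by (simp add: add_divide_distrib distrib_left)
  then have "(\<Sum>j\<in>UNIV. m $ j * w j) = (\<Sum>j\<in>UNIV. m $ j * ?G j / ?d j + S * (m $ j / ?d j))"
    by (intro sum.cong refl)
  also have "\<dots> = (\<Sum>j\<in>UNIV. m $ j * ?G j / ?d j) + S * (\<Sum>j\<in>UNIV. m $ j / ?d j)"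
    by (simp only: sum.distrib sum_distrib_left)
  finally have "S * (1 - (\<Sum>j\<in>UNIV. m $ j / ?d j)) = (\<Sum>j\<in>UNIV. m $ j * ?G j / ?d j)"
    unfolding S_def[symmetric] by (simp add: right_diff_distrib)
  then have "S = (\<Sum>j\<in>UNIV. m $ j * ?G j / ?d j) / (1 - (\<Sum>j\<in>UNIV. m $ j / ?d j))"
    using lin_diag_sum[OF pos] by (simp add: field_simps)
  then show ?thesis unfolding lin_sol_def using w[of i] by simp
qed

text \<open>Left in the form that the quotient rule delivers, so that it matches the differentiation
  rules; \<open>theta_of_deriv_solve\<close> brings it into linear-system form.\<close>

definition theta_of_deriv :: "real \<Rightarrow> (real^'N) \<times> (real^'N) \<times> real \<Rightarrow> (real^'N) \<times> (real^'N) \<times> real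
    \<Rightarrow> (real^'N) \<times> (real^'N) \<times> real" where
  "theta_of_deriv p x h = (\<chi> i. fst x $ i powr p * (fst h $ i * p / fst x $ i)
    - ((\<Sum>k\<in>UNIV. fst (snd x) $ k * (fst h $ k - fst h $ i) + fst (snd h) $ k * (fst x $ k - fst x $ i))
        * (snd (snd x) * fst x $ i)
      - (\<Sum>k\<in>UNIV. fst (snd x) $ k * (fst x $ k - fst x $ i))
        * (snd (snd x) * fst h $ i + snd (snd h) * fst x $ i))
      / ((snd (snd x) * fst x $ i) * (snd (snd x) * fst x $ i)), snd h)"

lemma theta_of_has_derivative:
  assumes "x \<in> pos_params"
  shows "(theta_of p has_derivative theta_of_deriv p x) (at x)"
  unfolding theta_of_def[abs_def] theta_of_deriv_def[abs_def]
proof (intro has_derivative_Pair has_derivative_vecI)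
  show "(snd has_derivative snd) (at x)" by (rule has_derivative_snd[OF has_derivative_ident])
  fix i
  have pos: "fst x $ i > 0" "snd (snd x) > 0" using assms by (auto simp: pos_vec_def)
  note [derivative_intros] = bounded_linear.has_derivative[OF bounded_linear_vec_nth]
  \<comment> \<open>The vanishing logarithm term is what the general rule for \<open>powr\<close>
    yields for a constant exponent; it is kept here for matching and simplified away
    afterwards.\<close>
  have "((\<lambda>x. fst x $ i powr p - (\<Sum>k\<in>UNIV. fst (snd x) $ k * (fst x $ k - fst x $ i)) / (snd (snd x) * fst x $ i))
     has_derivative (\<lambda>h. fst x $ i powr p * (0 * ln (fst x $ i) + fst h $ i * p / fst x $ i)
    - ((\<Sum>k\<in>UNIV. fst (snd x) $ k * (fst h $ k - fst h $ i) + fst (snd h) $ k * (fst x $ k - fst x $ i))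
        * (snd (snd x) * fst x $ i)
      - (\<Sum>k\<in>UNIV. fst (snd x) $ k * (fst x $ k - fst x $ i))
        * (snd (snd x) * fst h $ i + snd (snd h) * fst x $ i))
      / ((snd (snd x) * fst x $ i) * (snd (snd x) * fst x $ i)))) (at x)"
    by (rule derivative_intros | use pos in simp)+
  then show "((\<lambda>x. (\<chi> i. fst x $ i powr p
      - (\<Sum>k\<in>UNIV. fst (snd x) $ k * (fst x $ k - fst x $ i)) / (snd (snd x) * fst x $ i)) $ i)
    has_derivative (\<lambda>h. (\<chi> i. fst x $ i powr p * (fst h $ i * p / fst x $ i)
    - ((\<Sum>k\<in>UNIV. fst (snd x) $ k * (fst h $ k - fst h $ i) + fst (snd h) $ k * (fst x $ k - fst x $ i))
        * (snd (snd x) * fst x $ i)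
      - (\<Sum>k\<in>UNIV. fst (snd x) $ k * (fst x $ k - fst x $ i))
        * (snd (snd x) * fst h $ i + snd (snd h) * fst x $ i))
      / ((snd (snd x) * fst x $ i) * (snd (snd x) * fst x $ i))) $ i)) (at x)"
    by simp
qed

text \<open>Multiplying component \<open>i\<close> by \<open>\<sigma> * y $ i\<close> clears the
  denominators. The terms with the total mass times the \<open>i\<close>-th unknown, one from the
  coupling and one from the quotient rule, cancel; what remains is the system solved by
  \<open>lin_sol\<close>.\<close>

lemma theta_of_deriv_solve:
  fixes y m :: "real^'N"
  assumes pos: "p > 0" "\<sigma> > 0" "pos_vec m" "pos_vec y"
    and h: "theta_of_deriv p (y, m, \<sigma>) h = b"
  shows "fst h $ i = lin_sol p y m \<sigma> b i" "snd h = snd b"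
proof -
  show snd: "snd h = snd b" using h by (auto simp: theta_of_deriv_def)
  show "fst h $ i = lin_sol p y m \<sigma> b i"
  proof (rule lin_solI[OF pos])
    fix i
    let ?N = "\<Sum>k\<in>UNIV. m $ k * (y $ k - y $ i)" and ?w = "fst h" and ?\<mu> = "fst (snd b)" and ?\<tau> = "snd (snd b)"
    have yi: "y $ i > 0" using pos by (auto simp: pos_vec_def)
    have "fst b $ i = fst (theta_of_deriv p (y, m, \<sigma>) h) $ i" using h by simp
    also have "\<dots> = y $ i powr p * (?w $ i * p / y $ i)
      - ((\<Sum>k\<in>UNIV. m $ k * (?w $ k - ?w $ i) + ?\<mu> $ k * (y $ k - y $ i)) * (\<sigma> * y $ i)
        - ?N * (\<sigma> * ?w $ i + ?\<tau> * y $ i)) / ((\<sigma> * y $ i) * (\<sigma> * y $ i))"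
      by (simp add: theta_of_deriv_def snd)
    finally have "\<sigma> * y $ i * fst b $ i = \<sigma> * p * y $ i powr p * ?w $ i
      - (\<Sum>k\<in>UNIV. m $ k * (?w $ k - ?w $ i) + ?\<mu> $ k * (y $ k - y $ i))
      + ?N * ?w $ i / y $ i + ?\<tau> / \<sigma> * ?N"
      using yi pos(2) by (simp add: field_simps)
    moreover have "(\<Sum>k\<in>UNIV. m $ k * (?w $ k - ?w $ i) + ?\<mu> $ k * (y $ k - y $ i))
      = (\<Sum>k\<in>UNIV. m $ k * ?w $ k) - (\<Sum>k\<in>UNIV. m $ k) * ?w $ i + (\<Sum>k\<in>UNIV. ?\<mu> $ k * (y $ k - y $ i))"
      by (simp add: sum.distrib sum_subtractf right_diff_distrib sum_distrib_right)
    moreover have "?N * ?w $ i / y $ i = (\<Sum>k\<in>UNIV. m $ k * y $ k) / y $ i * ?w $ i - (\<Sum>k\<in>UNIV. m $ k) * ?w $ i"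
    proof -
      have "?N = (\<Sum>k\<in>UNIV. m $ k * y $ k) - (\<Sum>k\<in>UNIV. m $ k) * y $ i"
        by (simp add: sum_subtractf right_diff_distrib sum_distrib_right)
      moreover have "(a - c * z) * w / z = a / z * w - c * w" if "z > 0" for a c z w :: real
        using that by (simp add: field_simps)
      ultimately show ?thesis using yi by simp
    qed
    ultimately show "lin_diag p y m \<sigma> i * ?w $ i - (\<Sum>k\<in>UNIV. m $ k * ?w $ k) = lin_rhs y m \<sigma> b i"
      unfolding lin_diag_def lin_rhs_def by (simp add: distrib_right)
  qed
qed

text \<open>Inverse function theorem for \<open>theta_of\<close>, with the inverse known globally
  and explicitly. The formula for the derivative is read off by solving the linearised
  system.\<close>

lemma equilibrium_has_derivative:
  fixes x :: "(real^'N) \<times> (real^'N) \<times> real"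
  assumes p: "p > 0" and x: "x \<in> pos_params"
  shows "(equilibrium p has_derivative
    (\<lambda>b. \<chi> i. lin_sol p (equilibrium p x) (fst (snd x)) (snd (snd x)) b i)) (at x)"
proof -
  obtain \<theta> m \<sigma> where x_eq: "x = (\<theta>, m, \<sigma>)" and pos: "pos_vec \<theta>" "pos_vec m" "\<sigma> > 0" using x by auto
  define y where "y = equilibrium p x"
  have y: "pos_vec y" "OY_rhs p \<theta> m \<sigma> y = 0"
    using equilibrium[OF p pos(3,2,1)] unfolding y_def x_eq by auto
  let ?D = "theta_of_deriv p (y, m, \<sigma>)"
  have inP: "(y, m, \<sigma>) \<in> pos_params" using y pos by simp
  have der: "(theta_of p has_derivative ?D) (at (y, m, \<sigma>))"
    by (rule theta_of_has_derivative[OF inP])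
  then have lin: "linear ?D" by (rule has_derivative_linear)
  have "inj ?D"
  proof (rule linear_injective_0[OF lin, THEN iffD2], intro allI impI)
    fix h assume h: "?D h = 0"
    \<comment> \<open>A kernel vector solves the system with zero right-hand side, so it vanishes;
      injectivity then gives bijectivity in finite dimension.\<close>
    have "lin_sol p y m \<sigma> 0 i = 0" for i by (simp add: lin_sol_def lin_rhs_def)
    then have "fst h = 0" "snd h = 0"
      using theta_of_deriv_solve[OF p pos(3,2) y(1) h] by (auto simp: vec_eq_iff)
    then show "h = 0" by (simp add: prod_eq_iff)
  qed
  then obtain D' where D': "\<And>b. ?D (D' b) = b" using linear_injective_isomorphism[OF lin] by auto
  let ?g = "\<lambda>x. (equilibrium p x, snd x)"
  have "(?g has_derivative D') (at x)"
  proof (rule has_derivative_inverse_strong_x[where f = "theta_of p" and S = pos_params and f' = ?D])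
    show "continuous_on pos_params (theta_of p :: (real^'N) \<times> (real^'N) \<times> real \<Rightarrow> _)"
      by (intro continuous_at_imp_continuous_on ballI has_derivative_continuous[OF theta_of_has_derivative])
    show "?g x \<in> pos_params" using inP unfolding y_def x_eq by simp
    show "(theta_of p has_derivative ?D) (at (?g x))" using der unfolding y_def x_eq by simp
    show "?D \<circ> D' = id" using D' by auto
    show "theta_of p (?g x) = x"
      using OY_rhs_eq_0_iff_theta_of[OF y(1) pos(3)] y(2) unfolding y_def x_eq by simp
    \<comment> \<open>The new parameter \<open>\<theta>'\<close> may have nonpositive entries, but a
      positive equilibrium is unique for every \<theta>, so the left-inverse identity holds on all
      of \<open>pos_params\<close>.\<close>
    fix z :: "(real^'N) \<times> (real^'N) \<times> real" assume "z \<in> pos_params"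
    then obtain v \<mu> s where z: "z = (v, \<mu>, s)" "pos_vec v" "pos_vec \<mu>" "s > 0" by auto
    define \<theta>' where "\<theta>' = fst (theta_of p z)"
    have tz: "theta_of p z = (\<theta>', \<mu>, s)" unfolding \<theta>'_def z(1) by (simp add: theta_of_def)
    then have "OY_rhs p \<theta>' \<mu> s v = 0" using OY_rhs_eq_0_iff_theta_of[OF z(2,4)] z(1) by simp
    then show "?g (theta_of p z) = z" unfolding tz using equilibrium_eqI[OF p z(4,3,2)] z(1) by simp
  qed (rule open_pos_params)
  from has_derivative_fst[OF this] have "(equilibrium p has_derivative (\<lambda>b. fst (D' b))) (at x)" by simp
  moreover have "fst (D' b) = (\<chi> i. lin_sol p (equilibrium p x) (fst (snd x)) (snd (snd x)) b i)" for b
    using theta_of_deriv_solve(1)[OF p pos(3,2) y(1) D'] unfolding y_def x_eq by (simp add: vec_eq_iff)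
  ultimately show ?thesis by simp
qed

text \<open>The derivative is built by arithmetic and real powers from the parameters and the
  equilibrium itself, so class \<open>k\<close> of the latter gives class \<open>Suc k\<close>. Each
  partial derivative involves all components, hence the induction is for all \<open>i\<close>
  together.\<close>

lemma equilibrium_Cinf:
  assumes p: "p > 0"
  shows "Cinf_on (pos_params :: ((real^'N) \<times> (real^'N) \<times> real) set) (equilibrium p)"
proof -
  let ?P = "pos_params :: ((real^'N) \<times> (real^'N) \<times> real) set"
  note oP = open_pos_params[where ?'N = 'N]
  have pos: "snd (snd x) > 0" "pos_vec (fst (snd x))" "pos_vec (equilibrium p x)"
      "equilibrium p x $ i > 0" if "x \<in> ?P" for x i
    using that equilibrium[OF p] by (auto simp: pos_vec_def)
  have "Ck_on k ?P (\<lambda>x. equilibrium p x $ i)" for k i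
  proof (induction k arbitrary: i)
    case 0
    have "continuous_on ?P (equilibrium p)"
      by (intro continuous_at_imp_continuous_on ballI
          has_derivative_continuous[OF equilibrium_has_derivative[OF p]])
    then show ?case by (simp add: continuous_on_component)
  next
    case (Suc k)
    have m: "Ck_on k ?P (\<lambda>x. fst (snd x) $ j)" for j
      by (intro Ck_on_bounded_linear[OF oP] bounded_linear_compose[OF bounded_linear_vec_nth]
          bounded_linear_compose[OF bounded_linear_fst] bounded_linear_snd)
    have \<sigma>: "Ck_on k ?P (\<lambda>x. snd (snd x))"
      by (intro Ck_on_bounded_linear[OF oP] bounded_linear_compose[OF bounded_linear_snd] bounded_linear_snd)
    note arith = Ck_on_add[OF oP] Ck_on_diff[OF oP] Ck_on_mult[OF oP] Ck_on_sum[OF oP]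
      Ck_on_const[OF oP] Ck_on_powr[OF oP] Ck_on_divide[OF oP] m \<sigma> Suc.IH pos
    have d: "Ck_on k ?P (\<lambda>x. lin_diag p (equilibrium p x) (fst (snd x)) (snd (snd x)) j)" for j
      unfolding lin_diag_def by (intro arith)
    have G: "Ck_on k ?P (\<lambda>x. lin_rhs (equilibrium p x) (fst (snd x)) (snd (snd x)) b j)" for b j
      unfolding lin_rhs_def by (intro arith)
    \<comment> \<open>Positivity of the denominator of \<open>lin_sol\<close>, in the form asked for
      by \<open>Ck_on_divide\<close>.\<close>
    have "0 < 1 - (\<Sum>j\<in>UNIV. fst (snd x) $ j / lin_diag p (equilibrium p x) (fst (snd x)) (snd (snd x)) j)"
      if "x \<in> ?P" for x using lin_diag_sum[OF p pos(1-3)[OF that]] by simp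
    then have "Ck_on k ?P (\<lambda>x. lin_sol p (equilibrium p x) (fst (snd x)) (snd (snd x)) b i)" for b
      unfolding lin_sol_def
      by (intro arith d G lin_diag_pos[OF p])
    moreover have "((\<lambda>x. equilibrium p x $ i) has_derivative
        (\<lambda>b. lin_sol p (equilibrium p x) (fst (snd x)) (snd (snd x)) b i)) (at x)" if "x \<in> ?P" for x
      using bounded_linear.has_derivative[OF bounded_linear_vec_nth equilibrium_has_derivative[OF p that]] by simp
    ultimately show ?case by (intro Ck_on_SucI[OF oP])
  qed
  then show ?thesis unfolding Cinf_on_def by (intro allI Ck_on_vecI[OF oP])
qed

section \<open>Rescaling and local stability\<close>

text \<open>Substituting \<open>v i = y $ i *\<^sub>R u i\<close> splits each coupling term into a
  multiple of \<open>u k - u i\<close> and a multiple of \<open>u i\<close>. By the equilibrium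
  equation the latter sum to an expression that cancels \<theta>. The general normed space covers
  both the scalar and the vector system.\<close>

lemma rescaled_derivative:
  fixes v :: "'N::finite \<Rightarrow> real \<Rightarrow> 'a::real_normed_vector" and y m \<theta> :: "real^'N"
  assumes y: "pos_vec y" "OY_rhs p \<theta> m \<sigma> y = 0"
    and dv: "(v i has_vector_derivative
      (\<Sum>j\<in>UNIV. m $ j *\<^sub>R (v j t - v i t)) + (\<sigma> * (\<theta> $ i - norm (v i t) powr p)) *\<^sub>R v i t) (at t within S)"
  shows "((\<lambda>t. v i t /\<^sub>R y $ i) has_vector_derivative
      (\<Sum>k\<in>UNIV. (m $ k * y $ k / y $ i) *\<^sub>R (v k t /\<^sub>R y $ k - v i t /\<^sub>R y $ i))
      + (\<sigma> * y $ i powr p * (1 - norm (v i t /\<^sub>R y $ i) powr p)) *\<^sub>R (v i t /\<^sub>R y $ i)) (at t within S)"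
proof -
  define u where "u = (\<lambda>k. v k t /\<^sub>R y $ k)"
  have ypos: "y $ k > 0" for k using y by (simp add: pos_vec_def)
  have vu: "v k t = y $ k *\<^sub>R u k" for k using ypos[of k] unfolding u_def by simp
  \<comment> \<open>The equilibrium equation divided by \<open>y $ i\<close>: the total of the
    coefficients left on \<open>u i\<close>.\<close>
  have eq: "(\<Sum>k\<in>UNIV. m $ k * (y $ k - y $ i) / y $ i) = - \<sigma> * (\<theta> $ i - y $ i powr p)"
  proof -
    have "(\<Sum>k\<in>UNIV. m $ k * (y $ k - y $ i)) + \<sigma> * (\<theta> $ i - y $ i powr p) * y $ i = 0"
      using y by (simp add: OY_rhs_eq_0_iff)
    then have "(\<Sum>k\<in>UNIV. m $ k * (y $ k - y $ i)) = (- \<sigma> * (\<theta> $ i - y $ i powr p)) * y $ i"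
      by (simp add: eq_neg_iff_add_eq_0)
    then show ?thesis using ypos[of i] unfolding sum_divide_distrib[symmetric] by simp
  qed
  have nrm: "norm (v i t) powr p = y $ i powr p * norm (u i) powr p"
    using ypos[of i] by (simp add: vu powr_mult abs_of_pos)
  have "(m $ k *\<^sub>R (v k t - v i t)) /\<^sub>R y $ i
      = (m $ k * y $ k / y $ i) *\<^sub>R (u k - u i) + (m $ k * (y $ k - y $ i) / y $ i) *\<^sub>R u i" for k
  proof -
    have "m $ k / y $ i * y $ i = m $ k" using ypos[of i] by simp
    then have "(m $ k * y $ k / y $ i) *\<^sub>R (u k - u i) + (m $ k * (y $ k - y $ i) / y $ i) *\<^sub>R u i
        = (m $ k * y $ k / y $ i) *\<^sub>R u k - m $ k *\<^sub>R u i"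
      by (simp add: algebra_simps diff_divide_distrib flip: scaleR_add_left)
    then show ?thesis using ypos[of i] by (simp add: vu scaleR_diff_right divide_inverse mult_ac)
  qed
  then have "(\<Sum>j\<in>UNIV. m $ j *\<^sub>R (v j t - v i t)) /\<^sub>R y $ i
      = (\<Sum>k\<in>UNIV. (m $ k * y $ k / y $ i) *\<^sub>R (u k - u i)) + (- \<sigma> * (\<theta> $ i - y $ i powr p)) *\<^sub>R u i"
    by (simp only: scaleR_sum_right sum.distrib scaleR_sum_left[symmetric] eq)
  moreover have "((\<sigma> * (\<theta> $ i - norm (v i t) powr p)) *\<^sub>R v i t) /\<^sub>R y $ i
      = (\<sigma> * (\<theta> $ i - y $ i powr p * norm (u i) powr p)) *\<^sub>R u i"
    by (simp add: nrm u_def)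
  ultimately have "((\<Sum>j\<in>UNIV. m $ j *\<^sub>R (v j t - v i t)) + (\<sigma> * (\<theta> $ i - norm (v i t) powr p)) *\<^sub>R v i t) /\<^sub>R y $ i
      = (\<Sum>k\<in>UNIV. (m $ k * y $ k / y $ i) *\<^sub>R (u k - u i))
        + (- \<sigma> * (\<theta> $ i - y $ i powr p) + \<sigma> * (\<theta> $ i - y $ i powr p * norm (u i) powr p)) *\<^sub>R u i"
    by (simp only: scaleR_add_right scaleR_add_left add.assoc)
  also have "- \<sigma> * (\<theta> $ i - y $ i powr p) + \<sigma> * (\<theta> $ i - y $ i powr p * norm (u i) powr p)
      = \<sigma> * y $ i powr p * (1 - norm (u i) powr p)"
    by (simp add: algebra_simps)
  finally show ?thesis
    using bounded_linear.has_vector_derivative[OF bounded_linear_scaleR_right[of "inverse (y $ i)"] dv]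
    unfolding u_def by simp
qed

section \<open>Local exponential stability\<close>

lemma powr_decay_above_1:
  fixes x p :: real
  assumes "1 \<le> x" "0 < p"
  shows "(1 - x powr p) * x \<le> - p * (x - 1)"
proof -
  \<comment> \<open>Two tangent-line bounds, for the logarithm at \<open>1 / x\<close> and for the
    exponential, combine to \<open>x powr p \<ge> 1 + p * (1 - 1 / x)\<close>.\<close>
  have "ln (1 / x) \<le> 1 / x - 1" using assms by (intro ln_le_minus_one) simp
  then have "1 - 1 / x \<le> ln x" using assms by (simp add: ln_div)
  then have "1 + p * (1 - 1 / x) \<le> 1 + p * ln x" using assms by simp
  also have "\<dots> \<le> x powr p" using assms exp_ge_add_one_self[of "p * ln x"] by (simp add: powr_def)
  finally have "(p * (1 - 1 / x)) * x \<le> (x powr p - 1) * x" using assms by (intro mult_right_mono) auto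
  moreover have "(p * (1 - 1 / x)) * x = p * (x - 1)" using assms by (simp add: field_simps)
  ultimately show ?thesis by (simp add: algebra_simps)
qed

text \<open>Tangent-line bounds give \<open>1 - x powr p \<ge> x powr p * p * (1 - x)\<close>. The
  restoring term degenerates at 0, so a linear rate needs \<open>x\<close> bounded below; each of
  the factors \<open>x powr p\<close> and \<open>x\<close> is replaced by its value at 1/2.\<close>

lemma powr_growth_below_1:
  fixes x p :: real
  assumes "1 / 2 \<le> x" "x \<le> 1" "0 < p"
  shows "p * (1 / 2) powr p / 2 * (1 - x) \<le> (1 - x powr p) * x"
proof -
  have x0: "0 < x" using assms by simp
  have "p * (1 - x) \<le> - p * ln x" 
    using mult_left_mono[of "1 - x" "- ln x" p] ln_le_minus_one[OF x0] assms by simp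
  also have "\<dots> \<le> x powr - p - 1" using x0 exp_ge_add_one_self[of "- p * ln x"] by (simp add: powr_def)
  finally have "x powr p * (p * (1 - x)) \<le> x powr p * (x powr - p - 1)" by (intro mult_left_mono) auto
  also have "\<dots> = 1 - x powr p" using x0 by (simp add: right_diff_distrib flip: powr_add)
  finally have *: "x powr p * (p * (1 - x)) \<le> 1 - x powr p" .
  have "(1 / 2) powr p * (p * (1 - x)) \<le> x powr p * (p * (1 - x))"
    using assms by (intro mult_right_mono powr_mono2) auto
  also note *
  finally have "((1 / 2) powr p * (p * (1 - x))) * (1 / 2) \<le> (1 - x powr p) * x"
    using assms by (intro mult_mono) (auto intro!: mult_nonneg_nonneg powr_le1)
  then show ?thesis by (simp add: mult_ac)
qed

text \<open>Maximum principle for the deviations on both sides of 1. At an extremal component the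
  coupling pushes towards 1, and the radial term contracts faster than the barrier decays.\<close>

lemma rescaled_exp_decay:
  fixes u :: "'N::finite \<Rightarrow> real \<Rightarrow> real"
  assumes p: "p > 0" and A: "\<And>i k. A i k \<ge> 0" and \<beta>: "\<beta> > 0" "\<And>i. \<beta> \<le> b i"
    and flow: "\<And>i t. 0 \<le> t \<Longrightarrow> (u i has_real_derivative
        (\<Sum>k\<in>UNIV. A i k * (u k t - u i t)) + b i * (1 - \<bar>u i t\<bar> powr p) * u i t) (at t within {0..})"
    and init: "\<And>i. \<bar>u i 0 - 1\<bar> \<le> c0" and c0: "c0 < 1 / 2" and t: "0 \<le> t"
  shows "\<bar>u i t - 1\<bar> \<le> c0 * exp (- (\<beta> * p * (1 / 2) powr p / 4) * t)"
proof -
  \<comment> \<open>Half the rate guaranteed below 1, and less than the rate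
    \<open>\<beta> * p\<close> above 1, so contact inequalities are strict.\<close>
  define l where "l = \<beta> * p * (1 / 2) powr p / 4"
  have l: "l > 0" unfolding l_def using p \<beta> by simp
  define u' where "u' = (\<lambda>i t. (\<Sum>k\<in>UNIV. A i k * (u k t - u i t)) + b i * (1 - \<bar>u i t\<bar> powr p) * u i t)"
  \<comment> \<open>The Boolean selects the upper or the lower deviation, so one family controls
    both.\<close>
  define g where "g = (\<lambda>(i, up) t. if up then u i t - 1 else 1 - u i t)"
  define g' where "g' = (\<lambda>(i, up) t. if up then u' i t else - u' i t)"
  have du: "(u i has_real_derivative u' i t) (at t within {0..})" if "0 \<le> t" for i t
    unfolding u'_def by (rule flow[OF that])
  \<comment> \<open>A \<open>c\<close> above \<open>c0\<close> makes the initial inequality strict;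
    the limit \<open>c\<close> to \<open>c0\<close> is taken at the end.\<close>
  have lt: "g j t < c * exp (- l * t)" if c: "c0 < c" "c < 1 / 2" for c j
  proof (rule barrier_strict[where a = 0 and T = t and g = g and g' = g' and i = j
        and c = "\<lambda>t. c * exp (- l * t)" and c' = "\<lambda>t. - l * (c * exp (- l * t))"])
    fix j s assume "0 \<le> (s::real)"
    then show "(g j has_real_derivative g' j s) (at s within {0..})"
      unfolding g_def g'_def by (cases j) (auto intro!: derivative_eq_intros du)
  next
    fix s show "((\<lambda>t. c * exp (- l * t)) has_real_derivative - l * (c * exp (- l * s))) (at s within {0..})"
      by (auto intro!: derivative_eq_intros)
  next
    fix j :: "'N \<times> bool"
    show "g j 0 < c * exp (- l * 0)" using init[of "fst j"] c unfolding g_def by (cases j) (auto simp: abs_le_iff)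
  next
    fix j s assume s: "0 < s" "g j s = c * exp (- l * s)" "\<And>k. g k s \<le> c * exp (- l * s)"
    obtain i up where j: "j = (i, up)" by (cases j)
    define q where "q = c * exp (- l * s)"
    have c_pos: "0 < c" using init[of i] c by linarith
    then have q: "0 < q" unfolding q_def by simp
    \<comment> \<open>With \<open>q < 1/2\<close> the contact value \<open>1 - q\<close> lies in the
      range of \<open>powr_growth_below_1\<close>.\<close>
    have "q \<le> c * 1" unfolding q_def using c_pos l s by (intro mult_left_mono) auto
    then have q2: "q < 1 / 2" using c by simp
    have up: "u k s \<le> 1 + q" and lo: "1 - q \<le> u k s" for k
      using s(3)[of "(k, True)"] s(3)[of "(k, False)"] unfolding g_def q_def by auto
    have "g' j s < - l * q"
    proof (cases up)
      case True
      then have ui: "u i s = 1 + q" using s(2) unfolding g_def j q_def by simp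
      have "u' i s \<le> 0 + b i * - (p * q)"
        unfolding u'_def
      proof (rule add_mono)
        show "(\<Sum>k\<in>UNIV. A i k * (u k s - u i s)) \<le> 0"
          using A up by (intro sum_nonpos mult_nonneg_nonpos) (auto simp: ui)
        have "(1 - \<bar>u i s\<bar> powr p) * u i s \<le> - (p * q)"
          using powr_decay_above_1[of "1 + q" p] p q unfolding ui by simp
        then show "b i * (1 - \<bar>u i s\<bar> powr p) * u i s \<le> b i * - (p * q)"
          unfolding mult.assoc using \<beta>(1) \<beta>(2)[of i] by (intro mult_left_mono) auto
      qed
      also have "\<dots> \<le> - (\<beta> * (p * q))" using \<beta>(2)[of i] p q by (simp add: mult_right_mono)
      also have "\<dots> < - l * q"
      proof -
        have "(1 / 2) powr p \<le> (1::real)" using p by (intro powr_le1) auto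
        then have "(1 / 2) powr p / 4 < (1::real)" by simp
        then have "(\<beta> * p * q) * ((1 / 2) powr p / 4) < (\<beta> * p * q) * 1"
          using \<beta> p q by (intro mult_strict_left_mono) auto
        then show ?thesis unfolding l_def by (simp add: mult_ac)
      qed
      finally show ?thesis using True unfolding g'_def j by simp
    next
      case False
      then have ui: "u i s = 1 - q" using s(2) unfolding g_def j q_def by simp
      have "0 + b i * (p * (1 / 2) powr p / 2 * q) \<le> u' i s"
        unfolding u'_def
      proof (rule add_mono)
        show "0 \<le> (\<Sum>k\<in>UNIV. A i k * (u k s - u i s))"
          using A lo by (intro sum_nonneg mult_nonneg_nonneg) (auto simp: ui)
        have "p * (1 / 2) powr p / 2 * q \<le> (1 - \<bar>u i s\<bar> powr p) * u i s"
          using powr_growth_below_1[of "1 - q" p] p q q2 unfolding ui by simp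
        then show "b i * (p * (1 / 2) powr p / 2 * q) \<le> b i * (1 - \<bar>u i s\<bar> powr p) * u i s"
          unfolding mult.assoc using \<beta>(1) \<beta>(2)[of i] by (intro mult_left_mono) auto
      qed
      moreover have "\<beta> * (p * (1 / 2) powr p / 2 * q) \<le> b i * (p * (1 / 2) powr p / 2 * q)"
        using \<beta>(2)[of i] p q by (intro mult_right_mono) auto
      moreover have "l * q < \<beta> * (p * (1 / 2) powr p / 2 * q)"
        using \<beta> p q unfolding l_def by simp
      ultimately show ?thesis using False unfolding g'_def j by simp
    qed
    then show "g' j s < - l * (c * exp (- l * s))" unfolding q_def by simp
  qed (use t in auto)
  have "\<bar>u i t - 1\<bar> * exp (l * t) \<le> c0"
  proof (rule dense_ge_bounded[OF c0])
    fix c assume c: "c0 < c" "c < 1 / 2"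
    have "\<bar>u i t - 1\<bar> \<le> c * exp (- l * t)"
      using lt[OF c, of "(i, True)"] lt[OF c, of "(i, False)"] unfolding g_def by (simp add: abs_le_iff)
    then have "\<bar>u i t - 1\<bar> * exp (l * t) \<le> c * exp (- l * t) * exp (l * t)" by simp
    also have "\<dots> = c" by (simp add: mult.assoc flip: exp_add)
    finally show "\<bar>u i t - 1\<bar> * exp (l * t) \<le> c" .
  qed
  then have "\<bar>u i t - 1\<bar> * exp (l * t) * exp (- l * t) \<le> c0 * exp (- l * t)" by (intro mult_right_mono) auto
  then show ?thesis unfolding l_def[symmetric] by (simp add: mult.assoc flip: exp_add)
qed

lemma OY_solution_component:
  assumes "ode_solution (OY_rhs p \<theta> m \<sigma>) x" "0 \<le> t"
  shows "((\<lambda>t. x t $ i) has_vector_derivative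
    (\<Sum>j\<in>UNIV. m $ j *\<^sub>R (x t $ j - x t $ i)) + (\<sigma> * (\<theta> $ i - norm (x t $ i) powr p)) *\<^sub>R x t $ i) (at t within {0..})"
proof -
  have "(x has_vector_derivative OY_rhs p \<theta> m \<sigma> (x t)) (at t within {0..})"
    using assms by (simp add: ode_solution_def)
  from bounded_linear.has_vector_derivative[OF bounded_linear_vec_nth this, of i] show ?thesis
    by (simp add: OY_rhs_def)
qed

lemma OV_solution_component:
  assumes "ode_solution (OV_rhs p \<theta> m \<sigma>) v" "0 \<le> t"
  shows "((\<lambda>t. v t $ i) has_vector_derivative
    (\<Sum>j\<in>UNIV. m $ j *\<^sub>R (v t $ j - v t $ i)) + (\<sigma> * (\<theta> $ i - norm (v t $ i) powr p)) *\<^sub>R v t $ i) (at t within {0..})"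
proof -
  have "(v has_vector_derivative OV_rhs p \<theta> m \<sigma> (v t)) (at t within {0..})"
    using assms by (simp add: ode_solution_def)
  from bounded_linear.has_vector_derivative[OF bounded_linear_vec_nth this, of i] show ?thesis
    by (simp add: OV_rhs_def)
qed

text \<open>In the variables \<open>u i = x i / y $ i\<close> the claim is
  \<open>rescaled_exp_decay\<close>. The radius \<open>a / 2\<close>, with \<open>a\<close> the
  least component of \<open>y\<close>, forces every initial \<open>u i\<close> to within 1/2 of
  1.\<close>

lemma equilibrium_loc_exp_stable:
  fixes y m \<theta> :: "real^'N"
  assumes p: "p > 0" and \<sigma>: "\<sigma> > 0" and m: "pos_vec m" and y: "pos_vec y" "OY_rhs p \<theta> m \<sigma> y = 0"
  shows "loc_exp_stable (OY_rhs p \<theta> m \<sigma>) y"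
proof -
  have ypos: "y $ k > 0" and mpos: "m $ k > 0" for k using y m by (auto simp: pos_vec_def)
  define a where "a = Min (range (\<lambda>i. y $ i))"
  have "a \<in> range (\<lambda>i. y $ i)" unfolding a_def by (intro Min_in) auto
  then have a: "a > 0" using ypos by auto
  have a_le: "a \<le> y $ i" for i unfolding a_def by simp
  define \<beta> where "\<beta> = \<sigma> * a powr p"
  have \<beta>: "\<beta> > 0" "\<And>i. \<beta> \<le> \<sigma> * y $ i powr p"
    unfolding \<beta>_def using \<sigma> a a_le p by (auto intro!: powr_mono2)
  define l where "l = \<beta> * p * (1 / 2) powr p / 4"
  have l: "l > 0" unfolding l_def using \<beta> p by simp
  \<comment> \<open>Division by \<open>a\<close> comes from passing to relative deviations, the sum
    over \<open>y\<close> from bounding the norm by the sum of the components.\<close>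
  define C where "C = (\<Sum>i\<in>UNIV. y $ i) / a"
  have C: "C > 0" unfolding C_def using a ypos by (intro divide_pos_pos sum_pos) auto
  have "norm (x t - y) \<le> C * exp (- l * t) * norm (x 0 - y)"
    if x: "ode_solution (OY_rhs p \<theta> m \<sigma>) x" "norm (x 0 - y) < a / 2" and t: "0 \<le> t" for x t
  proof -
    define u where "u = (\<lambda>i t. x t $ i / y $ i)"
    define c0 where "c0 = norm (x 0 - y) / a"
    have dev: "\<bar>x t $ i - y $ i\<bar> = y $ i * \<bar>u i t - 1\<bar>" for i t
    proof -
      have "x t $ i - y $ i = y $ i * (u i t - 1)" unfolding u_def using ypos[of i] by (simp add: field_simps)
      then show ?thesis using ypos[of i] by (simp add: abs_mult)
    qed
    have "\<bar>u i t - 1\<bar> \<le> c0 * exp (- l * t)" for i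
      unfolding l_def
    proof (rule rescaled_exp_decay[OF p _ \<beta> _ _ _ t])
      show "0 \<le> m $ k * y $ k / y $ i" for i k using ypos mpos by (simp add: less_imp_le)
      show "c0 < 1 / 2" using x(2) a unfolding c0_def by (simp add: field_simps)
      fix i
      have "a * \<bar>u i 0 - 1\<bar> \<le> y $ i * \<bar>u i 0 - 1\<bar>" using a_le by (intro mult_right_mono) auto
      also have "\<dots> = \<bar>(x 0 - y) $ i\<bar>" by (simp add: dev)
      also have "\<dots> \<le> norm (x 0 - y)" by (rule component_le_norm_cart)
      finally show "\<bar>u i 0 - 1\<bar> \<le> c0" unfolding c0_def using a by (simp add: field_simps)
      fix s :: real assume "0 \<le> s"
      from rescaled_derivative[OF y, of "\<lambda>i t. x t $ i", OF OY_solution_component[OF x(1) this, of i]]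
      show "(u i has_real_derivative (\<Sum>k\<in>UNIV. m $ k * y $ k / y $ i * (u k s - u i s))
          + \<sigma> * y $ i powr p * (1 - \<bar>u i s\<bar> powr p) * u i s) (at s within {0..})"
        unfolding u_def has_real_derivative_iff_has_vector_derivative
        by (simp add: divide_inverse mult_ac)
    qed
    then have "norm (x t - y) \<le> (\<Sum>i\<in>UNIV. y $ i * (c0 * exp (- l * t)))"
      using ypos by (intro order_trans[OF norm_le_l1_cart] sum_mono) (auto simp: dev less_imp_le)
    also have "\<dots> = (\<Sum>i\<in>UNIV. y $ i) * (c0 * exp (- l * t))" by (rule sum_distrib_right[symmetric])
    also have "\<dots> = C * exp (- l * t) * norm (x 0 - y)" unfolding C_def c0_def by simp
    finally show ?thesis .
  qed
  then show ?thesis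
    unfolding loc_exp_stable_def using y(2) a C l
    by (intro conjI exI[of _ "a / 2"] exI[of _ C] exI[of _ l]) auto
qed

section \<open>Convergence of sectorial solutions\<close>

text \<open>Abstracts the rescaled system: in the application \<open>A i k\<close> is
  \<open>m $ k * y $ k / y $ i\<close> and \<open>b i\<close> is
  \<open>\<sigma> * y $ i powr p\<close>. The coupling need not be symmetric.\<close>

locale rescaled_flow =
  fixes u :: "'N::finite \<Rightarrow> real \<Rightarrow> 'a::euclidean_space"
    and A :: "'N \<Rightarrow> 'N \<Rightarrow> real" and b :: "'N \<Rightarrow> real" and p :: real and e :: 'a
  assumes p: "p > 0" and A: "\<And>i k. A i k > 0" and b: "\<And>i. b i > 0"
    and flow: "\<And>i t. 0 \<le> t \<Longrightarrow> (u i has_vector_derivative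
        (\<Sum>k\<in>UNIV. A i k *\<^sub>R (u k t - u i t)) + (b i * (1 - norm (u i t) powr p)) *\<^sub>R u i t)
        (at t within {0..})"
    and e: "norm e = 1" and sector: "\<And>i. e \<bullet> u i 0 > 0"
begin

abbreviation x :: "'N \<Rightarrow> real \<Rightarrow> real" where
  "x i t \<equiv> e \<bullet> u i t"

abbreviation x' :: "'N \<Rightarrow> real \<Rightarrow> real" where
  "x' i t \<equiv> (\<Sum>k\<in>UNIV. A i k * (x k t - x i t)) + b i * (1 - norm (u i t) powr p) * x i t"

lemma inner_flow:
  assumes "0 \<le> t"
  shows "((\<lambda>t. f \<bullet> u i t) has_real_derivative
    (\<Sum>k\<in>UNIV. A i k * (f \<bullet> u k t - f \<bullet> u i t)) + b i * (1 - norm (u i t) powr p) * (f \<bullet> u i t))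
    (at t within {0..})"
  using bounded_linear.has_vector_derivative[OF bounded_linear_inner_right flow[OF assms, of i], of f]
  by (simp add: has_real_derivative_iff_has_vector_derivative inner_sum_right inner_add_right inner_diff_right)

lemma x_flow: "0 \<le> a \<Longrightarrow> a \<le> t \<Longrightarrow> (x i has_real_derivative x' i t) (at t within {a..})"
  using inner_flow[of t e i] by (intro DERIV_subset[of "x i" _ t "{0..}" "{a..}"]) auto

lemma x_le_norm: "x i t \<le> norm (u i t)"
  using norm_cauchy_schwarz[of e "u i t"] e by simp

text \<open>On a compact time interval the solution is bounded, so the least component along
  \<open>e\<close> decays at most exponentially. This bound depends on the interval; it comes first
  because the ratios below divide by \<open>x\<close>, and a uniform bound follows in
  \<open>x_lower\<close>.\<close>

lemma x_pos:
  assumes t: "0 \<le> t"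
  shows "x i t > 0"
proof -
  have cont: "continuous_on {0..t} (u i)" for i
    unfolding continuous_on_eq_continuous_within
  proof (intro ballI)
    fix s assume "s \<in> {0..t}"
    then have "continuous (at s within {0..}) (u i)"
      by (intro has_vector_derivative_continuous[OF flow]) simp
    then show "continuous (at s within {0..t}) (u i)" by (rule continuous_within_subset) auto
  qed
  have "\<exists>R. \<forall>s\<in>{0..t}. norm (u i s) \<le> R" for i
    using compact_imp_bounded[OF compact_continuous_image[OF cont[of i] compact_Icc]]
    by (auto simp: bounded_iff)
  then obtain R where R: "\<And>i s. s \<in> {0..t} \<Longrightarrow> norm (u i s) \<le> R i"
    using choice[of "\<lambda>i R. \<forall>s\<in>{0..t}. norm (u i s) \<le> R"] by blast
  \<comment> \<open>The sum dominates each single damping coefficient on the interval; the added 1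
    makes this strict.\<close>
  define C where "C = (\<Sum>i\<in>UNIV. b i * R i powr p) + 1"
  define d where "d = Min (range (\<lambda>i. x i 0)) / 2"
  have "Min (range (\<lambda>i. x i 0)) \<in> range (\<lambda>i. x i 0)" by (intro Min_in) auto
  then have "d > 0" using sector unfolding d_def by auto
  have "- x i t < - d * exp (- C * t)"
  proof (rule barrier_strict[where a = 0 and T = t and g = "\<lambda>i t. - x i t"
        and c = "\<lambda>t. - d * exp (- C * t)" and g' = "\<lambda>i t. - x' i t" and c' = "\<lambda>t. C * d * exp (- C * t)"])
    fix i and s :: real assume "0 \<le> s"
    then show "((\<lambda>t. - x i t) has_real_derivative - x' i s) (at s within {0..})"
      by (intro DERIV_minus x_flow) auto
  next
    fix s
    show "((\<lambda>t. - d * exp (- C * t)) has_real_derivative C * d * exp (- C * s)) (at s within {0..})"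
      by (auto intro!: derivative_eq_intros)
  next
    fix j
    have "2 * d \<le> x j 0" unfolding d_def by simp
    then show "- x j 0 < - d * exp (- C * 0)" using \<open>d > 0\<close> by simp
  next
    fix j s assume s: "0 < s" "s \<le> t" "- x j s = - d * exp (- C * s)" "\<And>k. - x k s \<le> - d * exp (- C * s)"
    have xj: "x j s > 0" using s(3) \<open>d > 0\<close> by (simp add: zero_less_mult_iff)
    have "norm (u j s) powr p \<le> R j powr p" using R[of s j] s p by (intro powr_mono2) auto
    then have "b j * norm (u j s) powr p \<le> b j * R j powr p" using b[of j] by simp
    also have "\<dots> \<le> (\<Sum>i\<in>UNIV. b i * R i powr p)"
      using b by (intro member_le_sum) (auto simp: less_imp_le)
    also have "\<dots> < C" unfolding C_def by simp
    finally have "b j * norm (u j s) powr p * x j s < C * x j s" using xj by simp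
    moreover have "0 \<le> (\<Sum>k\<in>UNIV. A j k * (x k s - x j s))"
    proof (intro sum_nonneg mult_nonneg_nonneg)
      fix k show "0 \<le> x k s - x j s" using s(3) s(4)[of k] by linarith
    qed (use A in \<open>auto simp: less_imp_le\<close>)
    moreover have "b j * x j s > 0" using b xj by simp
    ultimately have "- x' j s < C * x j s" by (simp add: algebra_simps)
    also have "\<dots> = C * d * exp (- C * s)" using s(3) by simp
    finally show "- x' j s < C * d * exp (- C * s)" .
  qed (use t in auto)
  moreover have "d * exp (- C * t) > 0" using \<open>d > 0\<close> by simp
  ultimately show ?thesis by simp
qed

section \<open>Consensus of the ratios and convergence of directions\<close>

abbreviation r :: "'a \<Rightarrow> 'N \<Rightarrow> real \<Rightarrow> real" where
  "r f i t \<equiv> (f \<bullet> u i t) / x i t"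

abbreviation r' :: "'a \<Rightarrow> 'N \<Rightarrow> real \<Rightarrow> real" where
  "r' f i t \<equiv> (\<Sum>k\<in>UNIV. A i k * (x k t / x i t) * (r f k t - r f i t))"

text \<open>In the quotient rule the radial factor multiplies numerator and denominator alike and
  drops out. What is left is linear averaging with positive time-dependent weights.\<close>

lemma r_flow:
  assumes "0 \<le> a" "a \<le> t"
  shows "(r f i has_real_derivative r' f i t) (at t within {a..})"
proof -
  have t: "0 \<le> t" using assms by simp
  have x0: "x k t \<noteq> 0" for k using x_pos[OF t, of k] by simp
  let ?g = "b i * (1 - norm (u i t) powr p)"
  have "(((\<Sum>k\<in>UNIV. A i k * (f \<bullet> u k t - f \<bullet> u i t)) + ?g * (f \<bullet> u i t)) * x i t
      - (f \<bullet> u i t) * ((\<Sum>k\<in>UNIV. A i k * (x k t - x i t)) + ?g * x i t))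
    = (\<Sum>k\<in>UNIV. A i k * ((f \<bullet> u k t) * x i t - (f \<bullet> u i t) * x k t))"
    by (simp add: algebra_simps sum_distrib_left sum_distrib_right sum_subtractf)
  also have "\<dots> / (x i t * x i t) = r' f i t"
    unfolding sum_divide_distrib using x0 by (intro sum.cong) (auto simp: field_simps)
  finally have "(((\<Sum>k\<in>UNIV. A i k * (f \<bullet> u k t - f \<bullet> u i t)) + ?g * (f \<bullet> u i t)) * x i t
      - (f \<bullet> u i t) * ((\<Sum>k\<in>UNIV. A i k * (x k t - x i t)) + ?g * x i t)) / (x i t * x i t) = r' f i t"
    by simp
  moreover note DERIV_divide[OF inner_flow[OF t, of f i] inner_flow[OF t, of e i] x0]
  ultimately have "(r f i has_real_derivative r' f i t) (at t within {0..})" by simp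
  then show ?thesis by (rule DERIV_subset) (use assms in auto)
qed

text \<open>Averaging cannot raise the maximum. Lower bounds are obtained by applying this to
  \<open>- f\<close>.\<close>

lemma r_upper:
  assumes "0 \<le> a" "a \<le> t" "\<And>k. r f k a \<le> C"
  shows "r f i t \<le> C"
proof (rule barrier[where c' = "\<lambda>_. 0" and c = "\<lambda>_. C", OF r_flow[OF assms(1)] _ assms(3) _ assms(2)])
  fix i s assume s: "a < s" "\<And>k. r f k s \<le> r f i s"
  have "0 \<le> s" using s assms by simp
  then show "r' f i s \<le> 0" using s(2) A x_pos
    by (intro sum_nonpos mult_nonneg_nonpos) (auto simp: less_imp_le)
qed auto

text \<open>All ratios stay within their initial bounds, so the solution remains in a fixed cone
  around \<open>e\<close>; summing over basis directions gives the constant.\<close>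

lemma norm_le_x: "\<exists>K>0. \<forall>i t. 0 \<le> t \<longrightarrow> norm (u i t) \<le> K * x i t"
proof -
  define C where "C = (\<lambda>f. Max (range (\<lambda>i. \<bar>r f i 0\<bar>)))"
  have C: "\<bar>r f k 0\<bar> \<le> C f" for f k unfolding C_def by simp
  have r: "\<bar>r f i t\<bar> \<le> C f" if "0 \<le> t" for f i t
  proof -
    have le: "r f k 0 \<le> C f" "r (- f) k 0 \<le> C f" for k 
      using C[of f k, unfolded abs_le_iff] by simp_all
    show ?thesis
      using r_upper[OF order_refl that le(1), of i] r_upper[OF order_refl that le(2), of i]
      by (simp add: abs_le_iff)
  qed
  define K where "K = (\<Sum>f\<in>Basis. C f) + 1"
  have "0 \<le> (\<Sum>f\<in>Basis. C f)" 
    by (intro sum_nonneg order_trans[OF abs_ge_zero C[of _ undefined]])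
  then have "K > 0" unfolding K_def by simp
  moreover have "norm (u i t) \<le> K * x i t" if "0 \<le> t" for i t
  proof -
    have "norm (u i t) \<le> (\<Sum>f\<in>Basis. \<bar>u i t \<bullet> f\<bar>)" by (rule norm_le_l1)
    also have "\<dots> \<le> (\<Sum>f\<in>Basis. C f * x i t)"
    proof (rule sum_mono)
      fix f show "\<bar>u i t \<bullet> f\<bar> \<le> C f * x i t"
        using r[OF that, of f i] x_pos[OF that, of i]
        by (simp add: abs_divide divide_simps inner_commute)
    qed
    also have "\<dots> \<le> K * x i t"
      using x_pos[OF that, of i] unfolding K_def sum_distrib_right[symmetric] by (simp add: algebra_simps)
    finally show ?thesis .
  qed
  ultimately show ?thesis by blast
qed

text \<open>By the cone bound, \<open>x i t < 1 / K\<close> forces norm at most 1, where the radial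
  term does not damp. Hence the minimum cannot decrease below that level.\<close>

lemma x_lower: "\<exists>c>0. \<forall>i t. 0 \<le> t \<longrightarrow> c \<le> x i t"
proof -
  obtain K where K: "K > 0" "\<And>i t. 0 \<le> t \<Longrightarrow> norm (u i t) \<le> K * x i t"
    using norm_le_x by blast
  define d where "d = Min (range (\<lambda>i. x i 0))"
  have "d \<in> range (\<lambda>i. x i 0)" unfolding d_def by (intro Min_in) auto
  then have "d > 0" using sector by auto
  have d: "d \<le> x i 0" for i unfolding d_def by simp
  define c where "c = min d (1 / K)"
  have "- x i t \<le> - c" if "0 \<le> t" for i t
  proof (rule barrier[where a = 0 and c' = "\<lambda>_. 0" and c = "\<lambda>_. - c" and g' = "\<lambda>i t. - x' i t", OF _ _ _ _ that])
    fix i and s :: real assume "0 \<le> s"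
    then show "((\<lambda>t. - x i t) has_real_derivative - x' i s) (at s within {0..})"
      by (intro DERIV_minus x_flow) auto
  next
    fix i show "- x i 0 \<le> - c" using d[of i] unfolding c_def by simp
  next
    fix i s assume s: "0 < s" "- c < - x i s" "\<And>k. - x k s \<le> - x i s"
    have "norm (u i s) \<le> K * x i s" using K s by simp
    also have "\<dots> \<le> 1" using s K(1) unfolding c_def by (auto simp: field_simps)
    finally have "norm (u i s) powr p \<le> 1" using powr_mono2[of p "norm (u i s)" 1] p by simp
    then have "0 \<le> x' i s" using s A b x_pos[of s i]
      by (intro add_nonneg_nonneg sum_nonneg mult_nonneg_nonneg) (auto simp: less_imp_le)
    then show "- x' i s \<le> 0" by simp
  qed auto
  moreover have "c > 0" using \<open>d > 0\<close> K unfolding c_def by simp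
  ultimately show ?thesis by (metis neg_le_iff_le)
qed

text \<open>A component along \<open>e\<close> above 1 has norm above 1, where the radial term does
  not amplify.\<close>

lemma x_upper: "\<exists>C>0. \<forall>i t. 0 \<le> t \<longrightarrow> x i t \<le> C"
proof -
  define d where "d = Max (range (\<lambda>i. x i 0))"
  have d: "x i 0 \<le> d" for i unfolding d_def by simp
  define c where "c = max d 1"
  have "x i t \<le> c" if "0 \<le> t" for i t
  proof (rule barrier[where a = 0 and c' = "\<lambda>_. 0" and c = "\<lambda>_. c", OF x_flow _ _ _ that])
    fix i show "x i 0 \<le> c" using d[of i] unfolding c_def by simp
  next
    fix i s assume s: "0 < s" "c < x i s" "\<And>k. x k s \<le> x i s"
    have "1 \<le> norm (u i s)" using x_le_norm[of i s] s unfolding c_def by simp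
    then have "1 \<le> norm (u i s) powr p" using p by (simp add: ge_one_powr_ge_zero)
    then show "x' i s \<le> 0" using s A b x_pos[of s i]
      by (intro add_nonpos_nonpos sum_nonpos mult_nonneg_nonpos mult_nonpos_nonneg) (auto simp: less_imp_le)
  qed auto
  moreover have "c > 0" unfolding c_def by simp
  ultimately show ?thesis by blast
qed

text \<open>The uniform bounds on \<open>x\<close> keep all averaging weights above some \<alpha> >
  0, so the spread between the largest and smallest ratio shrinks exponentially.\<close>

lemma r_contracts: "\<exists>\<alpha>>0. \<exists>B. \<forall>i j t. 0 \<le> t \<longrightarrow> r f i t - r f j t \<le> B * exp (- \<alpha> * t)"
proof -
  obtain c where c: "c > 0" "\<And>i t. 0 \<le> t \<Longrightarrow> c \<le> x i t" using x_lower by blast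
  obtain C where C: "C > 0" "\<And>i t. 0 \<le> t \<Longrightarrow> x i t \<le> C" using x_upper by blast
  define a where "a = Min (range (\<lambda>(i,k). A i k))"
  have "a \<in> range (\<lambda>(i,k). A i k)" unfolding a_def by (intro Min_in) auto
  then have "a > 0" using A by auto
  have a: "a \<le> A i k" for i k unfolding a_def by (intro Min_le) auto
  define \<alpha> where "\<alpha> = a * (c / C)"
  have "\<alpha> > 0" using \<open>a > 0\<close> c C unfolding \<alpha>_def by simp
  have \<alpha>: "\<alpha> \<le> A i k * (x k t / x i t)" if "0 \<le> t" for i k t
    unfolding \<alpha>_def using a[of i k] \<open>a > 0\<close> c C that x_pos[OF that]
    by (intro mult_mono frac_le) (auto simp: less_imp_le)
  define B where "B = Max (range (\<lambda>(i,k). \<bar>r f i 0 - r f k 0\<bar>))"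
  have B: "\<bar>r f i 0 - r f k 0\<bar> \<le> B" for i k unfolding B_def by (intro Max_ge) auto
  \<comment> \<open>Indexed by ordered pairs: at a maximal pair the first index carries the largest
    ratio and the second the smallest.\<close>
  define g where "g = (\<lambda>(i,k) t. r f i t - r f k t)"
  define g' where "g' = (\<lambda>(i,k) t. r' f i t - r' f k t)"
  have "g ij t \<le> B * exp (- \<alpha> * t)" if t: "0 \<le> t" for ij t
  proof (rule barrier[where a = 0 and g' = g' and c' = "\<lambda>t. - \<alpha> * (B * exp (- \<alpha> * t))", OF _ _ _ _ t])
    fix ij s assume "0 \<le> (s::real)"
    then show "(g ij has_real_derivative g' ij s) (at s within {0..})"
      unfolding g_def g'_def
      by (cases ij) (simp only: prod.case, intro DERIV_diff r_flow, auto)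
  next
    fix s
    show "((\<lambda>t. B * exp (- \<alpha> * t)) has_real_derivative - \<alpha> * (B * exp (- \<alpha> * s))) (at s within {0..})"
      by (auto intro!: derivative_eq_intros)
  next
    fix ij show "g ij 0 \<le> B * exp (- \<alpha> * 0)" using B unfolding g_def by (cases ij) (auto simp: abs_le_iff)
  next
    fix ij s assume s: "0 < s" "B * exp (- \<alpha> * s) < g ij s" "\<And>k. g k s \<le> g ij s"
    obtain i j where ij: "ij = (i, j)" by (cases ij)
    have s0: "0 \<le> s" using s by simp
    have mx: "r f k s \<le> r f i s" for k using s(3)[of "(k, j)"] unfolding g_def ij by simp
    have mn: "r f j s \<le> r f k s" for k using s(3)[of "(i, k)"] unfolding g_def ij by simp
    \<comment> \<open>With every weight replaced by \<alpha> in both sums, the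
      \<open>r f k s\<close> terms cancel in the difference, leaving the spread multiplied by
      -\<alpha> once per index.\<close>
    have "r' f i s \<le> (\<Sum>k\<in>UNIV. \<alpha> * (r f k s - r f i s))"
      using \<alpha>[OF s0] mx by (intro sum_mono mult_right_mono_neg) auto
    moreover have "(\<Sum>k\<in>UNIV. \<alpha> * (r f k s - r f j s)) \<le> r' f j s"
      using \<alpha>[OF s0] mn by (intro sum_mono mult_right_mono) auto
    ultimately have "g' ij s \<le> (\<Sum>k\<in>UNIV. \<alpha> * (r f k s - r f i s)) - (\<Sum>k\<in>UNIV. \<alpha> * (r f k s - r f j s))"
      unfolding g'_def ij by simp
    also have "\<dots> = (\<Sum>k\<in>(UNIV::'N set). - \<alpha> * g ij s)"
      unfolding sum_subtractf[symmetric] g_def ij by (intro sum.cong) (auto simp: algebra_simps)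
    also have "\<dots> = real CARD('N) * (- \<alpha> * g ij s)" by simp
    also have "\<dots> \<le> 1 * (- \<alpha> * g ij s)"
    proof (rule mult_right_mono_neg)
      show "- \<alpha> * g ij s \<le> 0" using mn[of i] \<open>\<alpha> > 0\<close> unfolding g_def ij by simp
      show "1 \<le> real CARD('N)" using zero_less_card_finite[where ?'a='N] by linarith
    qed
    also have "\<dots> \<le> - \<alpha> * (B * exp (- \<alpha> * s))" using s(2) \<open>\<alpha> > 0\<close> by simp
    finally show "g' ij s \<le> - \<alpha> * (B * exp (- \<alpha> * s))" .
  qed
  from this[of _ "(_,_)"] have "\<forall>i j t. 0 \<le> t \<longrightarrow> r f i t - r f j t \<le> B * exp (- \<alpha> * t)"
    unfolding g_def by simp
  with \<open>\<alpha> > 0\<close> show ?thesis by blast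
qed

text \<open>After time \<open>s\<close> every ratio stays between the extremes reached at
  \<open>s\<close>, and their spread tends to zero. This gives a Cauchy property uniform in the
  index, hence one common limit.\<close>

lemma r_converges: "\<exists>\<rho>. \<forall>i. (r f i \<longlongrightarrow> \<rho>) at_top"
proof -
  obtain \<alpha> B where \<alpha>: "\<alpha> > 0" and B: "\<And>i j t. 0 \<le> t \<Longrightarrow> r f i t - r f j t \<le> B * exp (- \<alpha> * t)"
    using r_contracts[of f] by blast
  obtain \<beta> D where \<beta>: "\<beta> > 0" and D: "\<And>i j t. 0 \<le> t \<Longrightarrow> r (-f) i t - r (-f) j t \<le> D * exp (- \<beta> * t)"
    using r_contracts[of "-f"] by blast
  define h where "h = (\<lambda>t. B * exp (- \<alpha> * t) + D * exp (- \<beta> * t))"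
  have h0: "(h \<longlongrightarrow> 0) at_top"
  proof -
    have "((\<lambda>t. exp (- \<alpha> * t)) \<longlongrightarrow> 0) at_top" "((\<lambda>t. exp (- \<beta> * t)) \<longlongrightarrow> 0) at_top"
      using \<alpha> \<beta> by real_asymp+
    then have "((\<lambda>t. B * exp (- \<alpha> * t) + D * exp (- \<beta> * t)) \<longlongrightarrow> B * 0 + D * 0) at_top"
      by (intro tendsto_intros)
    then show ?thesis unfolding h_def by simp
  qed
  \<comment> \<open>Taking equal indices turns the left side of the spread bound into 0.\<close>
  have nonneg: "0 \<le> B * exp (- \<alpha> * t)" "0 \<le> D * exp (- \<beta> * t)" if "0 \<le> t" for t
    using B[OF that, of undefined undefined] D[OF that, of undefined undefined] by auto
  have key: "\<bar>r f i t - r f j s\<bar> \<le> h s" if "0 \<le> s" "s \<le> t" for i j s t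
  proof -
    have "r f k s \<le> r f j s + B * exp (- \<alpha> * s)" for k
      using B[OF that(1), of k j] by linarith
    then have "r f i t \<le> r f j s + B * exp (- \<alpha> * s)" by (rule r_upper[OF that])
    moreover have "r (-f) k s \<le> r (-f) j s + D * exp (- \<beta> * s)" for k
      using D[OF that(1), of k j] by linarith
    then have "r (-f) i t \<le> r (-f) j s + D * exp (- \<beta> * s)" by (rule r_upper[OF that])
    ultimately show ?thesis using nonneg[OF that(1)] unfolding h_def by (simp add: abs_le_iff)
  qed
  \<comment> \<open>Any fixed index serves: \<open>key\<close> compares values across indices, so
    the limit along integer times for one index is passed on to all indices and real times by
    \<open>limit_le\<close>.\<close>
  let ?i0 = "undefined :: 'N"
  have "Cauchy (\<lambda>n. r f ?i0 (real n))"
  proof (rule CauchyI')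
    fix \<epsilon> :: real assume "0 < \<epsilon>"
    have "eventually (\<lambda>t. h t < \<epsilon>) at_top" using order_tendstoD(2)[OF h0 \<open>0 < \<epsilon>\<close>] .
    then obtain T where T: "\<And>t. T \<le> t \<Longrightarrow> h t < \<epsilon>" by (auto simp: eventually_at_top_linorder)
    obtain M :: nat where M: "T \<le> real M" using real_arch_simple by blast
    show "\<exists>M. \<forall>m\<ge>M. \<forall>n>m. dist (r f ?i0 (real m)) (r f ?i0 (real n)) < \<epsilon>"
    proof (intro exI[of _ M] allI impI)
      fix m n assume mn: "M \<le> m" "m < (n::nat)"
      have "\<bar>r f ?i0 (real n) - r f ?i0 (real m)\<bar> \<le> h (real m)" using mn by (intro key) auto
      also have "\<dots> < \<epsilon>" using M mn by (intro T) linarith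
      finally show "dist (r f ?i0 (real m)) (r f ?i0 (real n)) < \<epsilon>" by (simp add: dist_real_def abs_minus_commute)
    qed
  qed
  then obtain \<rho> where \<rho>: "(\<lambda>n. r f ?i0 (real n)) \<longlonglongrightarrow> \<rho>"
    using Cauchy_convergent convergentD by blast
  have limit_le: "\<bar>\<rho> - r f i s\<bar> \<le> h s" if s: "0 \<le> s" for i s
  proof (rule tendsto_upperbound)
    show "((\<lambda>n. \<bar>r f ?i0 (real n) - r f i s\<bar>) \<longlongrightarrow> \<bar>\<rho> - r f i s\<bar>) sequentially"
      by (intro tendsto_intros \<rho>)
    obtain M :: nat where M: "s \<le> real M" using real_arch_simple by blast
    show "eventually (\<lambda>n. \<bar>r f ?i0 (real n) - r f i s\<bar> \<le> h s) sequentially"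
      using eventually_ge_at_top[of M] by eventually_elim (intro key, use M s in auto)
  qed simp
  have "eventually (\<lambda>s. norm (r f i s - \<rho>) \<le> h s) at_top" for i
    using eventually_ge_at_top[of 0]
    by eventually_elim (simp add: abs_minus_commute[of "r f i _"] limit_le)
  then have "((\<lambda>s. r f i s - \<rho>) \<longlongrightarrow> 0) at_top" for i
    by (rule Lim_null_comparison[OF _ h0])
  then show ?thesis using Lim_null by blast
qed

text \<open>The limit is assembled from the limits of the coordinate ratios; it lies on the
  hyperplane where the component along \<open>e\<close> is 1, as does every
  \<open>u i t /\<^sub>R x i t\<close>.\<close>

lemma direction_converges: "\<exists>w. e \<bullet> w = 1 \<and> (\<forall>i. ((\<lambda>t. u i t /\<^sub>R x i t) \<longlongrightarrow> w) at_top)"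
proof -
  obtain \<rho> where \<rho>: "\<And>f i. (r f i \<longlongrightarrow> \<rho> f) at_top" using choice[of "\<lambda>f \<rho>. \<forall>i. (r f i \<longlongrightarrow> \<rho>) at_top"] r_converges by blast
  define w where "w = (\<Sum>f\<in>Basis. \<rho> f *\<^sub>R f)"
  have lim: "((\<lambda>t. u i t /\<^sub>R x i t) \<longlongrightarrow> w) at_top" for i
  proof (rule tendsto_componentwise_iff[THEN iffD2], rule ballI)
    fix f :: 'a assume "f \<in> Basis"
    then have "w \<bullet> f = \<rho> f" unfolding w_def by simp
    then show "((\<lambda>t. (u i t /\<^sub>R x i t) \<bullet> f) \<longlongrightarrow> w \<bullet> f) at_top"
      using \<rho>[of f i] by (simp add: inner_commute[of "u i _" f] divide_inverse mult.commute)
  qed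
  have "((\<lambda>t. e \<bullet> (u undefined t /\<^sub>R x undefined t)) \<longlongrightarrow> e \<bullet> w) at_top"
    by (intro tendsto_intros lim)
  moreover have "eventually (\<lambda>t. e \<bullet> (u undefined t /\<^sub>R x undefined t) = 1) at_top"
    using eventually_ge_at_top[of 0] by eventually_elim (use x_pos in \<open>simp add: less_imp_neq[THEN not_sym]\<close>)
  then have "((\<lambda>t. e \<bullet> (u undefined t /\<^sub>R x undefined t)) \<longlongrightarrow> 1) at_top"
    by (rule tendsto_eventually)
  ultimately have "e \<bullet> w = 1" using tendsto_unique[OF trivial_limit_at_top_linorder] by blast
  with lim show ?thesis by blast
qed

text \<open>Once the norm is close to \<open>L * x i\<close>, the radial term resembles
  \<open>(1 - (L * x i) powr p) * x i\<close>, with positive rest point \<open>1 / L\<close>. The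
  maximum falls while above any level over \<open>1 / L\<close>, and the minimum rises while below
  any level under it.\<close>

lemma x_converges:
  assumes w: "L > 0" and lim: "\<And>i. ((\<lambda>t. norm (u i t) / x i t) \<longlongrightarrow> L) at_top"
  shows "(x i \<longlongrightarrow> 1 / L) at_top"
proof (rule order_tendstoI)
  obtain c where c: "c > 0" "\<And>i t. 0 \<le> t \<Longrightarrow> c \<le> x i t" using x_lower by blast
  define \<beta> where "\<beta> = Min (range b)"
  have "\<beta> \<in> range b" unfolding \<beta>_def by (intro Min_in) auto
  then have \<beta>: "\<beta> > 0" using b by auto
  have \<beta>_le: "\<beta> \<le> b i" for i unfolding \<beta>_def by simp
  {
    fix q' assume q': "1 / L < q'"
    define q where "q = (1 / L + q') / 2"
    have q: "1 / L < q" "q < q'" using q' unfolding q_def by auto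
    have q0: "0 < q" using q w by (meson divide_pos_pos less_trans zero_less_one)
    \<comment> \<open>Midway between \<open>1 / q\<close> and \<open>L\<close>: eventually a lower
      bound for the norm ratio, yet with \<open>q * l > 1\<close>, so damping at level
      \<open>q\<close> is uniform.\<close>
    define l where "l = (L + 1 / q) / 2"
    have l: "1 / q < l" "l < L" using q(1) q0 w unfolding l_def by (auto simp: field_simps)
    have l0: "0 < l" using l(1) q0 less_trans[of 0 "1 / q" l] by simp
    have ql: "1 < q * l" using l(1) q0 by (simp add: field_simps)
    have "eventually (\<lambda>t. \<forall>i. l < norm (u i t) / x i t) at_top"
      using order_tendstoD(1)[OF lim l(2)] by (simp add: eventually_all_finite)
    then obtain T where T: "\<And>t i. T \<le> t \<Longrightarrow> l < norm (u i t) / x i t"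
      by (auto simp: eventually_at_top_linorder)
    define a where "a = max T 0"
    define \<eta> where "\<eta> = \<beta> * ((q * l) powr p - 1) * q"
    have pw: "1 < (q * l) powr p" using ql p powr_less_mono2[of p 1 "q * l"] by simp
    show "eventually (\<lambda>t. x i t < q') at_top"
    proof (rule eventually_below_level[where a = a and q = q and \<eta> = \<eta>])
      fix i t assume t: "a \<le> t" "q < x i t" "\<And>k. x k t \<le> x i t"
      have "q * l \<le> norm (u i t)"
      proof -
        have "q * l \<le> x i t * l" using t l0 by (intro mult_right_mono) auto
        also have "\<dots> \<le> norm (u i t)" using T[of t i] t q0 unfolding a_def by (simp add: field_simps)
        finally show ?thesis .
      qed
      then have "(q * l) powr p \<le> norm (u i t) powr p" using ql p by (intro powr_mono2) auto
      moreover have "\<eta> \<le> b i * ((q * l) powr p - 1) * x i t"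
        unfolding \<eta>_def using \<beta> \<beta>_le[of i] pw t q0 by (intro mult_mono) auto
      moreover have "\<dots> \<le> b i * (norm (u i t) powr p - 1) * x i t"
        using calculation(1) b[of i] t q0 by (intro mult_right_mono mult_left_mono) auto
      moreover have "(\<Sum>k\<in>UNIV. A i k * (x k t - x i t)) \<le> 0"
        using t A by (intro sum_nonpos mult_nonneg_nonpos) (auto simp: less_imp_le)
      ultimately show "x' i t \<le> - \<eta>" by (simp add: algebra_simps)
    qed (use x_flow q \<beta> pw q0 in \<open>auto simp: a_def \<eta>_def\<close>)
  next
    fix q'' assume q'': "q'' < 1 / L"
    \<comment> \<open>The given level may be nonpositive; raising it to at least half of
      \<open>1 / L\<close> keeps the powers and reciprocals meaningful.\<close>
    define q' where "q' = max q'' (1 / L / 2)"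
    have q': "q' < 1 / L" "0 < q'" using q'' w unfolding q'_def by (auto simp: field_simps less_max_iff_disj)
    define q where "q = (1 / L + q') / 2"
    have q: "q < 1 / L" "q' < q" using q' unfolding q_def by auto
    have q0: "0 < q" using q q' by simp
    define l where "l = (L + 1 / q) / 2"
    have l: "l < 1 / q" "L < l" using q(1) q0 w unfolding l_def by (auto simp: field_simps)
    have ql: "q * l < 1" "0 < q * l" using l q0 w by (auto simp: field_simps)
    have "eventually (\<lambda>t. \<forall>i. norm (u i t) / x i t < l) at_top"
      using order_tendstoD(2)[OF lim l(2)] by (simp add: eventually_all_finite)
    then obtain T where T: "\<And>t i. T \<le> t \<Longrightarrow> norm (u i t) / x i t < l"
      by (auto simp: eventually_at_top_linorder)
    define a where "a = max T 0"
    \<comment> \<open>Growth is proportional to \<open>x\<close>, so a uniform rate uses the lower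
      bound \<open>c\<close> from \<open>x_lower\<close>.\<close>
    define \<eta> where "\<eta> = \<beta> * (1 - (q * l) powr p) * c"
    have pw: "(q * l) powr p < 1" using ql p powr_less_mono2[of p "q * l" 1] by simp
    have "eventually (\<lambda>t. - x i t < - q') at_top"
    proof (rule eventually_below_level[where a = a and q = "- q" and \<eta> = \<eta> and g' = "\<lambda>i t. - x' i t"])
      fix i t assume "a \<le> t"
      then show "((\<lambda>t. - x i t) has_real_derivative - x' i t) (at t within {a..})"
        by (intro DERIV_minus x_flow) (auto simp: a_def)
    next
      fix i t assume t: "a \<le> t" "- q < - x i t" "\<And>k. - x k t \<le> - x i t"
      have t0: "0 \<le> t" using t unfolding a_def by simp
      have "norm (u i t) \<le> q * l"
      proof -
        have "norm (u i t) \<le> x i t * l" using T[of t i] t x_pos[OF t0, of i] unfolding a_def by (simp add: field_simps)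
        also have "\<dots> \<le> q * l" using t l w by (intro mult_right_mono) auto
        finally show ?thesis .
      qed
      then have "norm (u i t) powr p \<le> (q * l) powr p" using p by (intro powr_mono2) auto
      moreover have "\<eta> \<le> b i * (1 - (q * l) powr p) * x i t"
        unfolding \<eta>_def using \<beta> \<beta>_le[of i] b[of i] pw c t0
        by (intro mult_mono) (auto simp: less_imp_le)
      moreover have "\<dots> \<le> b i * (1 - norm (u i t) powr p) * x i t"
        using calculation(1) b[of i] x_pos[OF t0, of i] by (intro mult_right_mono mult_left_mono) auto
      moreover have "0 \<le> (\<Sum>k\<in>UNIV. A i k * (x k t - x i t))"
        using t A by (intro sum_nonneg mult_nonneg_nonneg) (auto simp: less_imp_le)
      ultimately show "- x' i t \<le> - \<eta>" by (simp add: algebra_simps)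
    qed (use q \<beta> pw c in \<open>auto simp: \<eta>_def\<close>)
    then show "eventually (\<lambda>t. q'' < x i t) at_top"
      by eventually_elim (auto simp: q'_def)
  }
qed

text \<open>Combines the limits of \<open>x i\<close> and of the direction. Keeping
  \<open>e \<bullet> w > 0\<close> fixes the sign of the limit, which settles the scalar
  system.\<close>

theorem converges: "\<exists>w. norm w = 1 \<and> e \<bullet> w > 0 \<and> (\<forall>i. (u i \<longlongrightarrow> w) at_top)"
proof -
  obtain w where w: "e \<bullet> w = 1" "\<And>i. ((\<lambda>t. u i t /\<^sub>R x i t) \<longlongrightarrow> w) at_top"
    using direction_converges by blast
  have "w \<noteq> 0" using w(1) by auto
  then have L: "norm w > 0" by simp
  have "((\<lambda>t. norm (u i t) / x i t) \<longlongrightarrow> norm w) at_top" for i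
  proof (rule Lim_transform_eventually[OF tendsto_norm[OF w(2)]])
    show "eventually (\<lambda>t. norm (u i t /\<^sub>R x i t) = norm (u i t) / x i t) at_top"
      using eventually_ge_at_top[of 0] 
      by eventually_elim (simp add: x_pos abs_of_pos divide_inverse mult.commute)
  qed
  then have xlim: "(x i \<longlongrightarrow> 1 / norm w) at_top" for i using x_converges[OF L] by blast
  have "(u i \<longlongrightarrow> (1 / norm w) *\<^sub>R w) at_top" for i
  proof (rule Lim_transform_eventually[OF tendsto_scaleR[OF xlim w(2)]])
    show "eventually (\<lambda>t. x i t *\<^sub>R (u i t /\<^sub>R x i t) = u i t) at_top"
      using eventually_ge_at_top[of 0] by eventually_elim (use x_pos[of _ i] in \<open>simp add: less_imp_neq[THEN not_sym]\<close>)
  qed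
  then show ?thesis using w(1) L by (intro exI[of _ "(1 / norm w) *\<^sub>R w"]) auto
qed

end

section \<open>Return to the original variables and conclusion\<close>

lemma sectorial_solution_converges:
  fixes v :: "'N::finite \<Rightarrow> real \<Rightarrow> 'a::euclidean_space" and y m \<theta> :: "real^'N"
  assumes p: "p > 0" and \<sigma>: "\<sigma> > 0" and m: "pos_vec m" and y: "pos_vec y" "OY_rhs p \<theta> m \<sigma> y = 0"
    and dv: "\<And>i t. 0 \<le> t \<Longrightarrow> (v i has_vector_derivative
      (\<Sum>j\<in>UNIV. m $ j *\<^sub>R (v j t - v i t)) + (\<sigma> * (\<theta> $ i - norm (v i t) powr p)) *\<^sub>R v i t) (at t within {0..})"
    and e: "norm e = 1" "\<And>i. e \<bullet> v i 0 > 0"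
  shows "\<exists>w. norm w = 1 \<and> e \<bullet> w > 0 \<and> (\<forall>i. (v i \<longlongrightarrow> y $ i *\<^sub>R w) at_top)"
proof -
  have ypos: "y $ k > 0" and mpos: "m $ k > 0" for k using y m by (auto simp: pos_vec_def)
  interpret rescaled_flow "\<lambda>i t. v i t /\<^sub>R y $ i" "\<lambda>i k. m $ k * y $ k / y $ i" "\<lambda>i. \<sigma> * y $ i powr p" p e
  proof
    show "0 < \<sigma> * y $ i powr p" for i using ypos[of i] \<sigma> by simp
    show "0 < e \<bullet> (v i 0 /\<^sub>R y $ i)" for i using e(2)[of i] ypos[of i] by simp
  qed (use p ypos mpos e rescaled_derivative[OF y dv] in auto)
  obtain w where w: "norm w = 1" "e \<bullet> w > 0" "\<And>i. ((\<lambda>t. v i t /\<^sub>R y $ i) \<longlongrightarrow> w) at_top"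
    using converges by blast
  have "(v i \<longlongrightarrow> y $ i *\<^sub>R w) at_top" for i
    using tendsto_scaleR[OF tendsto_const w(3)[of i], of "y $ i"] ypos[of i] by simp
  with w show ?thesis by blast
qed

theorem theorem5p1:
  fixes p :: real
  assumes hp: "p > 0"
  shows "\<exists>ystar :: ((real^'N) \<times> (real^'N) \<times> real) \<Rightarrow> real^'N.
    (\<forall>\<theta> m \<sigma>. pos_vec \<theta> \<and> pos_vec m \<and> \<sigma> > 0 \<longrightarrow>
        (\<forall>y. (pos_vec y \<and> OY_rhs p \<theta> m \<sigma> y = 0) \<longleftrightarrow> y = ystar (\<theta>, m, \<sigma>))) \<and>
    Cinf_on {(\<theta>, m, \<sigma>). pos_vec \<theta> \<and> pos_vec m \<and> \<sigma> > 0} ystar \<and>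
    (\<forall>\<theta> m \<sigma>. pos_vec \<theta> \<and> pos_vec m \<and> \<sigma> > 0 \<longrightarrow>
        loc_exp_stable (OY_rhs p \<theta> m \<sigma>) (ystar (\<theta>, m, \<sigma>)) \<and>
        (\<forall>v :: real \<Rightarrow> (real^'n)^'N. ode_solution (OV_rhs p \<theta> m \<sigma>) v \<and> sectorial v \<longrightarrow>
            (\<exists>u :: real^'n. norm u = 1 \<and>
               (\<forall>i. ((\<lambda>t. v t $ i) \<longlongrightarrow> (ystar (\<theta>, m, \<sigma>) $ i) *\<^sub>R u) at_top))) \<and>
        (\<forall>y. ode_solution (OY_rhs p \<theta> m \<sigma>) y \<and> pos_vec (y 0) \<longrightarrow>
            (y \<longlongrightarrow> ystar (\<theta>, m, \<sigma>)) at_top))"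
proof (intro exI[of _ "equilibrium p"] conjI allI impI)
  show "Cinf_on {(\<theta>, m, \<sigma>). pos_vec \<theta> \<and> pos_vec m \<and> \<sigma> > 0}
      (equilibrium p :: (real^'N) \<times> (real^'N) \<times> real \<Rightarrow> real^'N)"
    by (rule equilibrium_Cinf[OF hp])
next
  fix \<theta> m :: "real^'N" and \<sigma> :: real
  assume params: "pos_vec \<theta> \<and> pos_vec m \<and> \<sigma> > 0"
  let ?y = "equilibrium p (\<theta>, m, \<sigma>)"
  have pos: "\<sigma> > 0" "pos_vec m" "pos_vec \<theta>" using params by auto
  note y = equilibrium[OF hp pos]
  show "(pos_vec y \<and> OY_rhs p \<theta> m \<sigma> y = 0) \<longleftrightarrow> y = ?y" for y
    using y equilibrium_eqI[OF hp pos(1,2)] by blast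
  show "loc_exp_stable (OY_rhs p \<theta> m \<sigma>) ?y"
    by (rule equilibrium_loc_exp_stable[OF hp pos(1,2) y])
  show "\<exists>u :: real^'n. norm u = 1 \<and> (\<forall>i. ((\<lambda>t. v t $ i) \<longlongrightarrow> ?y $ i *\<^sub>R u) at_top)"
    if v: "ode_solution (OV_rhs p \<theta> m \<sigma>) v \<and> sectorial v" for v :: "real \<Rightarrow> (real^'n)^'N"
  proof -
    obtain e :: "real^'n" where "norm e = 1" "\<And>i. e \<bullet> v 0 $ i > 0"
      using v by (auto simp: sectorial_def)
    then show ?thesis
      using sectorial_solution_converges[OF hp pos(1,2) y, of "\<lambda>i t. v t $ i" e]
        OV_solution_component[of p \<theta> m \<sigma> v] v by blast
  qed
  show "(x \<longlongrightarrow> ?y) at_top"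
    if x: "ode_solution (OY_rhs p \<theta> m \<sigma>) x \<and> pos_vec (x 0)" for x
  proof -
    \<comment> \<open>A positive scalar solution is sectorial in dimension one with
      \<open>e = 1\<close>; the limit direction has modulus 1 and positive sign, hence equals
      1.\<close>
    obtain w :: real where w: "\<bar>w\<bar> = 1" "w > 0" "\<And>i. ((\<lambda>t. x t $ i) \<longlongrightarrow> ?y $ i *\<^sub>R w) at_top"
      using sectorial_solution_converges[OF hp pos(1,2) y, of "\<lambda>i t. x t $ i" 1]
        OY_solution_component[of p \<theta> m \<sigma> x] x by (auto simp: pos_vec_def)
    then have "((\<lambda>t. x t $ i) \<longlongrightarrow> ?y $ i) at_top" for i by (metis abs_of_pos mult.right_neutral real_scaleR_def)
    then show ?thesis by (rule vec_tendstoI)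
  qed
qed

end
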